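(* Let $\mu\subseteq\lambda$ be strict partitions and let $z_0,z_1,z_2,\ldots$ be commuting variables. Then, as identities of rational functions, $$\sum_{T \in \mathrm{SYT}(\lambda/\mu)} T^B_{\bf z} = \sum_{D \in \mathcal E^B(\lambda/\mu)} \prod_{u \in [\lambda]^B \setminus D} \frac 1{h^B(u;{\bf z})} = \frac{1}{\prod_{u \in [\lambda]^B } h^B(u;{\bf z})} \sum_{D \in \mathcal E^B(\lambda/\mu)} \prod_{u \in D} h^B(u;{\bf z})$$ and $$\sum_{T \in \mathrm{SYT}(\lambda/\mu)} T^D_{\bf z} = \sum_{D \in \mathcal E^D(\lambda/\mu)} \prod_{u \in [\lambda]^D \setminus D} \frac 1{h^D(u;{\bf z})} = \frac{1}{\prod_{u \in [\lambda]^D } h^D(u;{\bf z})} \sum_{D \in \mathcal E^D(\lambda/\mu)} \prod_{u \in D} h^D(u;{\bf z}).$$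
   Context: A strict partition is a strictly decreasing finite (possibly empty) sequence $\lambda=(\lambda_1,\ldots,\lambda_\ell)$ of positive integers; $\ell(\lambda)=\ell$, $|\lambda|=\sum\lambda_i$, $\lambda_i=0$ for $i>\ell(\lambda)$. Its shifted diagrams are $[\lambda]^B=\{(i,j): 1\le i\le \ell(\lambda),\ i\le j\le \lambda_i+i-1\}$ and $[\lambda]^D=\{(i,j): 1\le i\le \ell(\lambda),\ i< j\le \lambda_i+i\}$ ($i$ = row, $j$ = column). $\mu\subseteq\lambda$ means $[\mu]^B\subseteq[\lambda]^B$ (equivalently $[\mu]^D\subseteq[\lambda]^D$), and $[\lambda/\mu]^B=[\lambda]^B\setminus[\mu]^B$, $[\lambda/\mu]^D=[\lambda]^D\setminus[\mu]^D$. Excited diagrams of type B: for $D\subseteq[\lambda]^B$, if $(i,j)\in D$, $(i+1,j+1)\in[\lambda]^B$, and none of $(i+1,j),(i,j+1),(i+1,j+1)$ is in $D$, then replacing $D$ by $(D\setminus\{(i,j)\})\cup\{(i+1,j+1)\}$ is an excited move of type B. $\mathcal E^B(\lambda/\mu)$ is the set of all subsets of $[\lambda]^B$ obtainable from $[\mu]^B$ by a (possibly empty) series of such moves. Excited diagrams of type D: for $D\subseteq[\lambda]^D$, an excited move of type D is either (a) for $(i,j)\in D$ with $i+1<j$ and $(i+1,j),(i,j+1),(i+1,j+1)\in[\lambda]^D\setminus D$, the replacement of $D$ by $(D\setminus\{(i,j)\})\cup\{(i+1,j+1)\}$; or (b) for $(i,i+1)\in D$ with $(i,i+2),(i,i+3),(i+1,i+2),(i+1,i+3),(i+2,i+3)\in[\lambda]^D\setminus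 D$, the replacement of $D$ by $(D\setminus\{(i,i+1)\})\cup\{(i+2,i+3)\}$. $\mathcal E^D(\lambda/\mu)$ is the set of all subsets of $[\lambda]^D$ obtainable from $[\mu]^D$ by a (possibly empty) series of such moves. Content: $c(i,j)=j-i$ for a cell $(i,j)$ (so in type B diagonal cells have content $0$, in type D content at least $1$). Type B hook of $(i,j)\in[\lambda]^B$ (a multiset of cells of $[\lambda]^B$): if $i=j$, all cells in row $i$; if $i<j\le\ell(\lambda)$, the cells of row $i$ weakly to the right of $(i,j)$, the cells of column $j$ below $(i,j)$, and the cells of row $j$, where the cell $(j,j)$ is counted twice; if $i<j$ and $j>\ell(\lambda)$, the cells of row $i$ weakly to the right of $(i,j)$ and the cells of column $j$ below $(i,j)$. Type D hook of $(i,j)\in[\lambda]^D$: the cells of row $i$ weakly to the right of $(i,j)$, the cells of column $j$ below $(i,j)$, and the cells of row $j$ (none if $j>\ell(\lambda)$). The weighted hook length $h^B(u;{\bf z})$ (resp. $h^D(u;{\bf z})$) is the sum of $z_{c(v)}$ over all cells $v$ (with multiplicity) in the type B (resp. D) hook of $u$, hooks being taken in the diagram of $\lambda$. A standard Young tableau of skew shifted shape $\lambda/\mu$, with $n=|\lambda|-|\mu|$, is a bijection $T$ from the cells of $[\lambda/\mu]^B$ (or, equivalently, shifting columns by one, of $[\lambda/\mu]^D$) to $\{1,\ldots,n\}$ that increases along rows (left to right) and down columns; $\mathrm{SYT}(\lambda/\mu)$ is the set of them. Put $$T^B_{\bf z} = \prod_{k=1}^n \frac 1{z_{c(T^{-1}(n))}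 + z_{c(T^{-1}(n-1))} + \cdots + z_{c(T^{-1}(k))}},$$ where $T^{-1}(k)$ is the cell with entry $k$, viewed as a cell of $[\lambda/\mu]^B$; $T^D_{\bf z}$ is given by the same formula with cells viewed in $[\lambda/\mu]^D$ (i.e. all indices of the $z$'s are increased by $1$). *)

theory Defs
  imports
    "HOL-Library.Multiset"
    "HOL-Library.FuncSet"
    "HOL-Library.Poly_Mapping"
    "HOL-Computational_Algebra.Fraction_Field"
begin

section \<open>Rational functions in the variables z 0, z 1, z 2, ...\<close>

text \<open>
  A monomial is a finitely supported exponent function and a polynomial a finitely supported
  coefficient function on monomials; rational functions form the fraction field of the resulting
  integral domain.
\<close>

type_synonym 'k ratfun = "((nat \<Rightarrow>\<^sub>0 nat) \<Rightarrow>\<^sub>0 'k) fract"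

definition ratvar :: "nat \<Rightarrow> ('k::field_char_0) ratfun" where
  "ratvar i = Fract (Poly_Mapping.single (Poly_Mapping.single i 1) 1) 1"


section \<open>Strict partitions and shifted diagrams\<close>

definition strict_partition :: "nat list \<Rightarrow> bool" where
  "strict_partition lam \<longleftrightarrow> sorted_wrt (>) lam \<and> (\<forall>x\<in>set lam. 0 < x)"

text \<open>Parts are numbered from 1, and so are rows and columns; a cell is (row, column).\<close>

definition part :: "nat list \<Rightarrow> nat \<Rightarrow> nat" where
  "part lam i = (if 1 \<le> i \<and> i \<le> length lam then lam ! (i - 1) else 0)"

type_synonym cell = "nat \<times> nat"

definition diagB :: "nat list \<Rightarrow> cell set" where
  "diagB lam = {(i, j). 1 \<le> i \<and> i \<le> length lam \<and> i \<le> j \<and> j \<le> part lam i + i - 1}"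

definition diagD :: "nat list \<Rightarrow> cell set" where
  "diagD lam = {(i, j). 1 \<le> i \<and> i \<le> length lam \<and> i < j \<and> j \<le> part lam i + i}"

definition sub_partition :: "nat list \<Rightarrow> nat list \<Rightarrow> bool" where
  "sub_partition mu lam \<longleftrightarrow> diagB mu \<subseteq> diagB lam"

text \<open>All cells of the diagrams satisfy i <= j, so the truncated subtraction is harmless.\<close>

definition content :: "cell \<Rightarrow> nat" where
  "content u = snd u - fst u"


section \<open>Excited diagrams\<close>

definition excited_moveB :: "nat list \<Rightarrow> cell set \<Rightarrow> cell set \<Rightarrow> bool" where
  "excited_moveB lam D D' \<longleftrightarrow> D \<subseteq> diagB lam \<and>
     (\<exists>i j. (i, j) \<in> D \<and> (i + 1, j + 1) \<in> diagB lam \<and>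
        (i + 1, j) \<notin> D \<and> (i, j + 1) \<notin> D \<and> (i + 1, j + 1) \<notin> D \<and>
        D' = (D - {(i, j)}) \<union> {(i + 1, j + 1)})"

definition excitedB :: "nat list \<Rightarrow> nat list \<Rightarrow> cell set set" where
  "excitedB lam mu = {D. D \<subseteq> diagB lam \<and> (excited_moveB lam)\<^sup>*\<^sup>* (diagB mu) D}"

definition excited_moveD :: "nat list \<Rightarrow> cell set \<Rightarrow> cell set \<Rightarrow> bool" where
  "excited_moveD lam D D' \<longleftrightarrow> D \<subseteq> diagD lam \<and>
     ((\<exists>i j. (i, j) \<in> D \<and> i + 1 < j \<and>
         {(i + 1, j), (i, j + 1), (i + 1, j + 1)} \<subseteq> diagD lam - D \<and>
         D' = (D - {(i, j)}) \<union> {(i + 1, j + 1)}) \<or>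
      (\<exists>i. (i, i + 1) \<in> D \<and>
         {(i, i + 2), (i, i + 3), (i + 1, i + 2), (i + 1, i + 3), (i + 2, i + 3)}
           \<subseteq> diagD lam - D \<and>
         D' = (D - {(i, i + 1)}) \<union> {(i + 2, i + 3)}))"

definition excitedD :: "nat list \<Rightarrow> nat list \<Rightarrow> cell set set" where
  "excitedD lam mu = {D. D \<subseteq> diagD lam \<and> (excited_moveD lam)\<^sup>*\<^sup>* (diagD mu) D}"


section \<open>Hooks and weighted hook lengths\<close>

definition row_from :: "cell set \<Rightarrow> cell \<Rightarrow> cell set" where
  "row_from S u = {v \<in> S. fst v = fst u \<and> snd u \<le> snd v}"

definition col_below :: "cell set \<Rightarrow> cell \<Rightarrow> cell set" where
  "col_below S u = {v \<in> S. snd v = snd u \<and> fst u < fst v}"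

definition row :: "cell set \<Rightarrow> nat \<Rightarrow> cell set" where
  "row S i = {v \<in> S. fst v = i}"

text \<open>
  In the case i < j <= length lam, the cell (j, j) lies both in column j below (i, j) and in row j,
  so the multiset sum gives it multiplicity exactly two.
\<close>

definition hookB :: "nat list \<Rightarrow> cell \<Rightarrow> cell multiset" where
  "hookB lam u =
     (let S = diagB lam in
      if fst u = snd u then mset_set (row S (fst u))
      else if snd u \<le> length lam
      then mset_set (row_from S u) + mset_set (col_below S u) + mset_set (row S (snd u))
      else mset_set (row_from S u) + mset_set (col_below S u))"

definition hookD :: "nat list \<Rightarrow> cell \<Rightarrow> cell multiset" where
  "hookD lam u =
     (let S = diagD lam in
      mset_set (row_from S u) + mset_set (col_below S u) + mset_set (row S (snd u)))"

definition hB :: "(nat \<Rightarrow> 'a::comm_monoid_add) \<Rightarrow> nat list \<Rightarrow> cell \<Rightarrow> 'a" where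
  "hB z lam u = (\<Sum>v\<in>#hookB lam u. z (content v))"

definition hD :: "(nat \<Rightarrow> 'a::comm_monoid_add) \<Rightarrow> nat list \<Rightarrow> cell \<Rightarrow> 'a" where
  "hD z lam u = (\<Sum>v\<in>#hookD lam u. z (content v))"


section \<open>Standard Young tableaux of skew shifted shape\<close>

definition skewB :: "nat list \<Rightarrow> nat list \<Rightarrow> cell set" where
  "skewB lam mu = diagB lam - diagB mu"

definition skew_size :: "nat list \<Rightarrow> nat list \<Rightarrow> nat" where
  "skew_size lam mu = sum_list lam - sum_list mu"

text \<open>
  A tableau is a function on all of \<open>cell\<close>; extensionality makes each one occur once.
\<close>

definition SYT :: "nat list \<Rightarrow> nat list \<Rightarrow> (cell \<Rightarrow> nat) set" where
  "SYT lam mu =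
     {T \<in> extensional (skewB lam mu).
        bij_betw T (skewB lam mu) {1..skew_size lam mu} \<and>
        (\<forall>i j j'. (i, j) \<in> skewB lam mu \<and> (i, j') \<in> skewB lam mu \<and> j < j' \<longrightarrow> T (i, j) < T (i, j')) \<and>
        (\<forall>i i' j. (i, j) \<in> skewB lam mu \<and> (i', j) \<in> skewB lam mu \<and> i < i' \<longrightarrow> T (i, j) < T (i', j))}"

definition cell_of :: "nat list \<Rightarrow> nat list \<Rightarrow> (cell \<Rightarrow> nat) \<Rightarrow> nat \<Rightarrow> cell" where
  "cell_of lam mu T k = inv_into (skewB lam mu) T k"

text \<open>The bijection from type B cells to type D cells.\<close>

definition to_D :: "cell \<Rightarrow> cell" where
  "to_D u = (fst u, snd u + 1)"

definition tabB ::
  "(nat \<Rightarrow> 'a::field) \<Rightarrow> nat list \<Rightarrow> nat list \<Rightarrow> (cell \<Rightarrow> nat) \<Rightarrow> 'a" where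
  "tabB z lam mu T =
     (\<Prod>k = 1..skew_size lam mu. 1 / (\<Sum>m = k..skew_size lam mu. z (content (cell_of lam mu T m))))"

definition tabD ::
  "(nat \<Rightarrow> 'a::field) \<Rightarrow> nat list \<Rightarrow> nat list \<Rightarrow> (cell \<Rightarrow> nat) \<Rightarrow> 'a" where
  "tabD z lam mu T =
     (\<Prod>k = 1..skew_size lam mu. 1 / (\<Sum>m = k..skew_size lam mu. z (content (to_D (cell_of lam mu T m)))))"

end

theory Submission
  imports Defs
begin

text \<open>
  Both sides satisfy the recursion obtained by deleting the smallest entry of a tableau: the sum over
  tableaux of shape \<open>lam/mu\<close>, multiplied by the sum of the variables of \<open>lam/mu\<close>, is the sum over all
  shapes covering \<open>mu\<close>. For the excited diagrams this is the equivariant Chevalley formula. It is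
  proved by induction on \<open>lam\<close>. Reading the cells of \<open>lam\<close> in an order in which the diagram can be
  grown, excited diagrams are the subsets whose labels, as a subword, build up \<open>mu\<close>, and the weighted
  hook lengths are the inversions of the corresponding reduced word. Adding a cell to \<open>lam\<close> thus
  applies a simple reflection to all hook lengths, and because the spin weights are minuscule the
  reflected identity for \<open>lam\<close> is, up to adding or removing one cell of \<open>mu\<close>, the identity for the
  larger shape. Evaluating at arbitrary points of the reflection representation instead of working with
  rational functions makes the reflections act by substitution.
\<close>

section \<open>Shifted shapes as row-length functions\<close>

text \<open>The induction step uses the hypothesis at \<open>refl c x\<close>, and a reflected point
  is in general no longer a sequence of partial sums of the variables. The Chevalley identity is
  therefore free of division and holds for every \<open>x\<close>. Denominators enter only in
  \<open>hook_formula\<close>, and it is applied only at partial sums, where each hook length and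
  each weight of a nonempty set of cells is a nonempty sum of variables. A given label can be added
  to a shape in at most one way, removed in at most one way, and never both. The induction step thus
  has three cases, and diamonds for two different labels match the covers of neighbouring shapes. In
  type B the hook length of an off-diagonal cell (i, j) is x at the length of row i, plus x at the
  length of row j if that row is nonempty, and otherwise minus x at the length missing in column j.
  Adding a cell to a nonempty row exchanges two consecutive values among row lengths and missing
  lengths; adding one to an empty row turns the missing length 1 into a row and flips a sign. This
  is why one reflection transforms all hook lengths at once. Type D is similar.\<close>

definition shape :: "(nat \<Rightarrow> nat) \<Rightarrow> bool" where
  "shape f \<longleftrightarrow> f 0 = 0 \<and> finite {i. f i \<noteq> 0} \<and> (\<forall>i\<ge>1. f (Suc i) < f i \<or> f (Suc i) = 0)"

definition cells :: "(nat \<Rightarrow> nat) \<Rightarrow> cell set" where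
  "cells f = {(i, j). i \<le> j \<and> j < i + f i}"

definition len :: "(nat \<Rightarrow> nat) \<Rightarrow> nat" where
  "len f = card {i. f i \<noteq> 0}"

abbreviation bump :: "(nat \<Rightarrow> nat) \<Rightarrow> nat \<Rightarrow> nat \<Rightarrow> nat" where
  "bump f r \<equiv> f(r := Suc (f r))"

definition valid :: "cell \<Rightarrow> bool" where
  "valid u \<longleftrightarrow> 1 \<le> fst u \<and> fst u \<le> snd u"

text \<open>This is the order of the poset of cells, with the smaller cell to the northwest, not the
  position on the page. Shapes are order ideals for it (\<open>cells_down\<close>).\<close>

definition below :: "cell \<Rightarrow> cell \<Rightarrow> bool" where
  "below u v \<longleftrightarrow> fst u \<le> fst v \<and> snd u \<le> snd v"

lemma shape_zero: "shape (\<lambda>_. 0)"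
  by (simp add: shape_def)

lemma shape_min: "shape f \<Longrightarrow> shape g \<Longrightarrow> shape (\<lambda>i. min (f i) (g i))"
  unfolding shape_def
  by (auto intro: finite_subset[of _ "{i. f i \<noteq> 0}"] simp: min_def)

lemma shape_mono:
  assumes "shape f" "1 \<le> i" "i < k"
  shows "f k < f i \<or> f k = 0"
  using assms(3)
proof (induction k)
  case (Suc k)
  show ?case
  proof (cases "i = k")
    case True
    then show ?thesis using assms by (auto simp: shape_def)
  next
    case False
    then have "f k < f i \<or> f k = 0" using Suc by simp
    moreover have "f (Suc k) < f k \<or> f (Suc k) = 0"
      using assms False Suc.prems by (auto simp: shape_def)
    ultimately show ?thesis by linarith
  qed
qed simp

lemma shape_inj:
  assumes "shape f" "f i = f k" "f i \<noteq> 0"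
  shows "i = k"
proof -
  have "1 \<le> i" "1 \<le> k" using assms by (auto simp: shape_def Suc_le_eq intro!: Nat.gr0I)
  then show ?thesis
    using shape_mono[OF assms(1), of i k] shape_mono[OF assms(1), of k i] assms
    by (metis less_irrefl linorder_neqE_nat)
qed

text \<open>Going one row down loses at least 1 in length and gains exactly 1 by the shift, so the
  right ends of nonempty rows weakly recede.\<close>

lemma shape_diff:
  assumes "shape f" "1 \<le> i" "i \<le> k" "f k \<noteq> 0"
  shows "f k + k \<le> f i + i"
  using assms(3,4)
proof (induction k rule: dec_induct)
  case (step n)
  then have "f (Suc n) < f n" using shape_mono[OF assms(1), of n "Suc n"] assms(2) by linarith
  then show ?case using step by simp
qed simp

lemma initial_segment:
  fixes S :: "nat set"
  assumes "finite S" "0 \<notin> S" "\<And>k i. k \<in> S \<Longrightarrow> 1 \<le> i \<Longrightarrow> i \<le> k \<Longrightarrow> i \<in> S"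
  shows "i \<in> S \<longleftrightarrow> 1 \<le> i \<and> i \<le> card S"
proof -
  obtain n where n: "S = {1..n}"
  proof (cases "S = {}")
    case True
    then show thesis using that[of 0] by simp
  next
    case False
    have "S = {1..Max S}"
      using assms Max_in[OF assms(1) False]
      by (auto simp: Suc_le_eq intro!: Nat.gr0I)
    then show thesis by (rule that)
  qed
  show ?thesis unfolding n by simp
qed

lemma nonzero_iff_len:
  assumes "shape f"
  shows "f i \<noteq> 0 \<longleftrightarrow> 1 \<le> i \<and> i \<le> len f"
proof -
  have "i \<in> {i. f i \<noteq> 0} \<longleftrightarrow> 1 \<le> i \<and> i \<le> len f" unfolding len_def
  proof (rule initial_segment)
    fix k i assume "k \<in> {i. f i \<noteq> 0}" "1 \<le> i" "i \<le> k"
    then show "i \<in> {i. f i \<noteq> 0}" using shape_mono[OF assms, of i k] by (cases "i = k") auto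
  qed (use assms in \<open>auto simp: shape_def\<close>)
  then show ?thesis by simp
qed

section \<open>Addable cells: uniqueness, diamonds, commutation\<close>

lemma shape_bump_iff:
  assumes "shape f"
  shows "shape (bump f r) \<longleftrightarrow> r = 1 \<or> (\<exists>k\<ge>1. r = Suc k \<and> Suc (f r) < f k)"
proof
  assume L: "shape (bump f r)"
  then have "r \<noteq> 0" by (cases "r = 0") (auto simp: shape_def)
  show "r = 1 \<or> (\<exists>k\<ge>1. r = Suc k \<and> Suc (f r) < f k)"
  proof (rule ccontr)
    assume n: "\<not> (r = 1 \<or> (\<exists>k\<ge>1. r = Suc k \<and> Suc (f r) < f k))"
    then obtain k where k: "r = Suc k" "k \<ge> 1" using \<open>r \<noteq> 0\<close> by (cases r) (auto simp: Suc_le_eq)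
    then show False using L n unfolding shape_def by auto
  qed
next
  assume R: "r = 1 \<or> (\<exists>k\<ge>1. r = Suc k \<and> Suc (f r) < f k)"
  have "finite {i. bump f r i \<noteq> 0}"
    by (rule finite_subset[of _ "insert r {i. f i \<noteq> 0}"]) (use assms in \<open>auto simp: shape_def\<close>)
  then show "shape (bump f r)" using R assms unfolding shape_def by (auto simp: less_Suc_eq)
qed

lemma bump_pos: "shape (bump f r) \<Longrightarrow> 1 \<le> r"
  by (cases r) (auto simp: shape_def)

lemma cells_valid: "shape f \<Longrightarrow> u \<in> cells f \<Longrightarrow> valid u"
  by (auto simp: cells_def valid_def shape_def Suc_le_eq intro!: Nat.gr0I)

lemma cells_zero: "cells (\<lambda>_. 0) = {}"
  by (auto simp: cells_def)

lemma cells_bump: "cells (bump f r) = insert (r, r + f r) (cells f)"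
  by (auto simp: cells_def split: if_splits)

lemma new_cell_notin: "(r, r + f r) \<notin> cells f"
  by (simp add: cells_def)

lemma cells_mono_iff: "cells f \<subseteq> cells g \<longleftrightarrow> (\<forall>i. f i \<le> g i)"
proof
  assume L: "cells f \<subseteq> cells g"
  show "\<forall>i. f i \<le> g i"
  proof (rule ccontr)
    assume "\<not> ?thesis"
    then obtain i where "g i < f i" by (auto simp: not_le)
    then have "(i, i + g i) \<in> cells f" "(i, i + g i) \<notin> cells g" by (auto simp: cells_def)
    then show False using L by blast
  qed
qed (force simp: cells_def intro: less_le_trans)

lemma cells_inj: "cells f = cells g \<Longrightarrow> f = g"
  by (metis antisym cells_mono_iff ext order_refl)

lemma finite_cells: "shape f \<Longrightarrow> finite (cells f)"
proof -
  assume "shape f"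
  then have "finite (Sigma {i. f i \<noteq> 0} (\<lambda>i. {i..<i + f i}))"
    by (auto simp: shape_def)
  then show ?thesis by (rule finite_subset[rotated]) (auto simp: cells_def)
qed

lemma cells_down:
  assumes "shape f" "v \<in> cells f" "valid u" "below u v"
  shows "u \<in> cells f"
proof -
  obtain i j k l where u: "u = (i, j)" and v: "v = (k, l)" by (cases u, cases v)
  have "f k \<noteq> 0" using assms(2) v by (auto simp: cells_def)
  then have "f k + k \<le> f i + i"
    using shape_diff[OF assms(1), of i k] assms u v by (auto simp: valid_def below_def)
  then show ?thesis using assms u v by (auto simp: cells_def valid_def below_def)
qed

text \<open>A positive length determines its row, and among the empty rows only the first can
  receive a cell. Hence the content of an addable cell determines the cell.\<close>

lemma addable_unique:
  assumes "shape f" "shape (bump f r)" "shape (bump f s)" "f r = f s"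
  shows "r = s"
proof (cases "f r = 0")
  case True
  have "\<not> a < b" if ab: "shape (bump f a)" "shape (bump f b)" "f a = 0" "f b = 0" for a b
  proof
    assume "a < b"
    moreover have "1 \<le> a" using ab bump_pos by blast
    ultimately obtain k where k: "b = Suc k" "k \<ge> 1" "f k > 1"
      using ab(2,4) \<open>a < b\<close> iffD1[OF shape_bump_iff[OF assms(1), of b]] by force
    then have "a \<le> k" using \<open>a < b\<close> by simp
    then show False using shape_mono[OF assms(1), of a k] ab \<open>1 \<le> a\<close> k
      by (cases "a = k") auto
  qed
  then show ?thesis using assms True by (metis linorder_neqE_nat)
next
  case False
  then show ?thesis using assms shape_inj by blast
qed

lemma addable_diamond:
  assumes "shape f" "shape (bump f r)" "shape (bump f s)" "r \<noteq> s"
  shows "shape (bump (bump f r) s)"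
proof -
  have "s = 1 \<or> (\<exists>k\<ge>1. s = Suc k \<and> Suc (f s) < f k)"
    using assms shape_bump_iff by blast
  then show ?thesis unfolding shape_bump_iff[OF assms(2)] using assms(4) by auto
qed

lemma removable_diamond:
  assumes "shape g" "shape g'" "bump g r = bump g' s" "shape (bump g r)" "r \<noteq> s"
  obtains f where "shape f" "g = bump f s" "g' = bump f r"
proof
  \<comment> \<open>The shape below both is their intersection.\<close>
  let ?f = "\<lambda>i. min (g i) (g' i)"
  show "shape ?f" using shape_min[OF assms(1,2)] .
  have a: "bump g r i = bump g' s i" for i using assms(3) by simp
  have r: "Suc (g r) = g' r" using a[of r] assms(5) by simp
  have s: "g s = Suc (g' s)" using a[of s] assms(5) by simp
  have o: "g i = g' i" if "i \<noteq> r" "i \<noteq> s" for i using a[of i] that by simp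
  show "g = bump ?f s"
  proof
    fix i show "g i = bump ?f s i" using r s o[of i] by (cases "i = r"; cases "i = s") auto
  qed
  show "g' = bump ?f r"
  proof
    fix i show "g' i = bump ?f r i" using r s o[of i] by (cases "i = r"; cases "i = s") auto
  qed
qed

text \<open>A second cell of the same content never fits directly afterwards: a positive length
  occurs in one row only, and the next diagonal cell needs a row of length at least 2 above
  it.\<close>

lemma no_repeat:
  assumes "shape f" "shape (bump f r)" "shape (bump (bump f r) s)"
  shows "bump f r s \<noteq> f r"
proof
  assume eq: "bump f r s = f r"
  then have "s \<noteq> r" "f s = f r" by (auto split: if_splits)
  show False
  proof (cases "f r = 0")
    case False
    then show False using shape_inj[OF assms(1) \<open>f s = f r\<close>] \<open>s \<noteq> r\<close> \<open>f s = f r\<close> by auto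
  next
    case True
    obtain k where "s = 1 \<or> (k \<ge> 1 \<and> s = Suc k \<and> Suc (bump f r s) < bump f r k)"
      using assms shape_bump_iff by blast
    moreover have "r \<ge> 1" using bump_pos assms by blast
    ultimately consider "s = 1" | "s = Suc k" "k \<noteq> r" "k \<ge> 1" "Suc (f s) < f k"
      using \<open>s \<noteq> r\<close> True by (auto split: if_splits)
    then show False
    proof cases
      case 1
      then have "bump f r r < bump f r s \<or> bump f r r = 0"
        using shape_mono[OF assms(2), of s r] \<open>s \<noteq> r\<close> \<open>r \<ge> 1\<close> by auto
      then show False using \<open>s \<noteq> r\<close> True \<open>f s = f r\<close> by auto
    next
      case 2
      then have "shape (bump f s)" using shape_bump_iff[OF assms(1)] by auto
      then show False using addable_unique[OF assms(1,2)] \<open>s \<noteq> r\<close> \<open>f s = f r\<close> by metis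
    qed
  qed
qed

text \<open>New cells whose contents differ by at least 2 share no side, so neither supports the
  other.\<close>

lemma addable_commute:
  assumes "shape f" "shape (bump f r)" "shape (bump (bump f r) s)"
    and far: "bump f r s + 2 \<le> f r \<or> f r + 2 \<le> bump f r s"
  shows "r \<noteq> s" "shape (bump f s)" "shape (bump (bump f s) r)"
proof -
  show ne: "r \<noteq> s" using far by auto
  have "s = 1 \<or> (\<exists>k\<ge>1. s = Suc k \<and> Suc (bump f r s) < bump f r k)"
    using assms shape_bump_iff by blast
  then have "s = 1 \<or> (\<exists>k\<ge>1. s = Suc k \<and> Suc (f s) < f k)"
    using far ne by (auto split: if_splits)
  then show 2: "shape (bump f s)" using shape_bump_iff[OF assms(1)] by blast
  show "shape (bump (bump f s) r)"
    using addable_diamond[OF assms(1) 2 assms(2)] ne by simp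
qed

section \<open>Growth orders of a shape\<close>

inductive grow :: "cell list \<Rightarrow> (nat \<Rightarrow> nat) \<Rightarrow> bool" where
  grow_Nil: "grow [] (\<lambda>_. 0)"
| grow_Cons: "grow vs f \<Longrightarrow> shape g \<Longrightarrow> g = bump f r \<Longrightarrow> grow ((r, r + f r) # vs) g"

lemma grow_shape: "grow vs f \<Longrightarrow> shape f"
  by (erule grow.cases) (simp_all only: shape_zero)

lemma grow_set: "grow vs f \<Longrightarrow> set vs = cells f"
  by (induction rule: grow.induct) (simp_all only: cells_bump cells_zero list.set)

lemma grow_exists:
  assumes "shape f"
  shows "\<exists>vs. grow vs f"
  using assms
proof (induction "card (cells f)" arbitrary: f)
  case 0
  then have "cells f = cells (\<lambda>_. 0)" using finite_cells by (auto simp: cells_def)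
  then show ?case using cells_inj grow_Nil by blast
next
  case (Suc n)
  have "len f \<noteq> 0"
  proof
    assume "len f = 0"
    then have "f i = 0" for i using nonzero_iff_len[OF Suc.prems, of i] by auto
    then have "cells f = {}" by (auto simp: cells_def)
    then show False using Suc by simp
  qed
  \<comment> \<open>The last cell of the last nonempty row can always be removed.\<close>
  let ?r = "len f" and ?g = "f(len f := f (len f) - 1)"
  have r: "f ?r \<noteq> 0" "f (Suc ?r) = 0"
    using \<open>len f \<noteq> 0\<close> nonzero_iff_len[OF Suc.prems, of ?r] nonzero_iff_len[OF Suc.prems, of "Suc ?r"] by auto
  have eq: "bump ?g ?r = f" using r by auto
  have "finite {i. ?g i \<noteq> 0}"
    by (rule finite_subset[of _ "{i. f i \<noteq> 0}"]) (use Suc.prems in \<open>auto simp: shape_def split: if_splits\<close>)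
  then have sh: "shape ?g" using Suc.prems r by (fastforce simp: shape_def)
  have "card (cells f) = Suc (card (cells ?g))"
    using cells_bump[of ?g ?r] new_cell_notin[of ?r ?g] finite_cells[OF sh] unfolding eq
    by (metis card_insert_disjoint)
  then obtain vs where "grow vs ?g" using Suc.hyps sh by auto
  from grow_Cons[OF this Suc.prems eq[symmetric]] show ?case by blast
qed

section \<open>Excited diagrams as subwords\<close>

text \<open>\<open>nxt u\<close> is the target of an excited move of \<open>u\<close>, and
  \<open>blk u\<close> is the set of cells that must be free for it. The key assumption is
  \<open>blk_far\<close>: a cell that does not block, is not below \<open>u\<close> and not above
  \<open>nxt u\<close> has content at distance at least 2, so its letter commutes with that of
  \<open>u\<close>. By \<open>nxt_chain\<close>, equal labels along the order are linked by
  moves.\<close>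

locale excited_type =
  fixes lab :: "cell \<Rightarrow> nat"
    and nxt :: "cell \<Rightarrow> cell"
    and blk :: "cell \<Rightarrow> cell set"
  assumes lab_content: "valid u \<Longrightarrow> valid v \<Longrightarrow> lab u = lab v \<Longrightarrow> content u = content v"
    and nxt_valid: "valid u \<Longrightarrow> valid (nxt u)"
    and nxt_lab: "valid u \<Longrightarrow> lab (nxt u) = lab u"
    and nxt_above: "valid u \<Longrightarrow> below u (nxt u)" "valid u \<Longrightarrow> nxt u \<noteq> u"
    and blk_above: "valid u \<Longrightarrow> y \<in> blk u \<Longrightarrow> below u y \<and> y \<noteq> u"
    and blk_below: "valid u \<Longrightarrow> y \<in> blk u \<Longrightarrow> below y (nxt u)"
    and nxt_blk: "valid u \<Longrightarrow> nxt u \<in> blk u"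
    and blk_far: "valid u \<Longrightarrow> valid y \<Longrightarrow> \<not> below y u \<Longrightarrow> \<not> below (nxt u) y \<Longrightarrow> y \<notin> blk u \<Longrightarrow>
      content y + 2 \<le> content u \<or> content u + 2 \<le> content y"
    and nxt_chain: "valid u \<Longrightarrow> valid v \<Longrightarrow> lab u = lab v \<Longrightarrow> below u v \<Longrightarrow> \<exists>m. v = (nxt ^^ m) u"
begin

definition step :: "(nat \<Rightarrow> nat) \<Rightarrow> nat \<Rightarrow> (nat \<Rightarrow> nat) \<Rightarrow> bool" where
  "step f c g \<longleftrightarrow> shape f \<and> shape g \<and> (\<exists>r. g = bump f r \<and> lab (r, r + f r) = c)"

definition move :: "cell set \<Rightarrow> cell set \<Rightarrow> cell set \<Rightarrow> bool" where
  "move S D D' \<longleftrightarrow> D \<subseteq> S \<and>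
     (\<exists>u\<in>D. nxt u \<in> S \<and> blk u \<inter> D = {} \<and> D' = insert (nxt u) (D - {u}))"

definition excited :: "cell set \<Rightarrow> cell set \<Rightarrow> cell set set" where
  "excited S T = {D. D \<subseteq> S \<and> (move S)\<^sup>*\<^sup>* T D}"

text \<open>
  Words list the cells in reverse order of insertion: \<open>acts vs D g\<close> says that adding to the empty
  shape cells with the labels of those \<open>v \<in> D\<close>, last list entry first, is possible and yields \<open>g\<close>.
\<close>

fun acts :: "cell list \<Rightarrow> cell set \<Rightarrow> (nat \<Rightarrow> nat) \<Rightarrow> bool" where
  "acts [] D g \<longleftrightarrow> g = (\<lambda>_. 0)"
| "acts (v # vs) D g \<longleftrightarrow> (if v \<in> D then \<exists>f. acts vs D f \<and> step f (lab v) g else acts vs D g)"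

section \<open>Steps with a fixed label\<close>

lemma valid_new: "shape (bump f r) \<Longrightarrow> valid (r, r + f r)"
  using bump_pos[of f r] by (simp add: valid_def)

lemma stepE:
  assumes "step f c g"
  obtains r where "shape f" "shape (bump f r)" "g = bump f r" "lab (r, r + f r) = c"
  using assms unfolding step_def by blast

lemma stepI:
  assumes "shape f" "shape (bump f r)"
  shows "step f (lab (r, r + f r)) (bump f r)"
  using assms unfolding step_def by blast

lemma new_lab_content:
  assumes "shape (bump f r)" "shape (bump g s)" "lab (r, r + f r) = lab (s, s + g s)"
  shows "f r = g s"
  using lab_content[OF valid_new[OF assms(1)] valid_new[OF assms(2)] assms(3)]
  by (simp add: content_def)

text \<open>Together with \<open>step_inj\<close> and \<open>step_twice\<close> this is the
  minuscule property: strings of steps with one label have length at most 1.\<close>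

lemma step_fun: "step f c g \<Longrightarrow> step f c h \<Longrightarrow> g = h"
  by (elim stepE) (metis addable_unique new_lab_content)

lemma step_inj:
  assumes "step f c h" "step g c h"
  shows "f = g"
proof -
  obtain r where r: "shape f" "shape (bump f r)" "h = bump f r" "lab (r, r + f r) = c"
    using assms(1) by (rule stepE)
  obtain s where s: "shape g" "shape (bump g s)" "h = bump g s" "lab (s, s + g s) = c"
    using assms(2) by (rule stepE)
  have "f r = g s" using r s new_lab_content by metis
  moreover have "h r = Suc (f r)" unfolding r(3) by simp
  moreover have "h s = Suc (g s)" unfolding s(3) by simp
  moreover have "shape h" using r by simp
  ultimately have "r = s" using shape_inj by (metis nat.distinct(1))
  show ?thesis
  proof
    fix i show "f i = g i"
      using fun_cong[OF r(3), of i] fun_cong[OF s(3), of i] \<open>r = s\<close> by (auto split: if_splits)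
  qed
qed

lemma step_twice:
  assumes "step f c g"
  shows "\<not> step g c h"
proof
  assume "step g c h"
  then obtain s where s: "shape (bump g s)" "lab (s, s + g s) = c" by (rule stepE)
  obtain r where r: "shape f" "shape (bump f r)" "g = bump f r" "lab (r, r + f r) = c"
    using assms by (rule stepE)
  have "f r = g s" by (rule new_lab_content[OF r(2) s(1)]) (simp add: r(4) s(2))
  then show False using no_repeat[OF r(1,2) s(1)[unfolded r(3)]] r(3) by simp
qed

lemma step_diamond:
  assumes "step f b g" "step f c g'" "b \<noteq> c"
  obtains h where "step g c h" "step g' b h"
proof -
  obtain r where r: "shape f" "shape (bump f r)" "g = bump f r" "lab (r, r + f r) = b"
    using assms(1) by (rule stepE)
  obtain s where s: "shape (bump f s)" "g' = bump f s" "lab (s, s + f s) = c"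
    using assms(2) by (rule stepE)
  have ne: "r \<noteq> s" using r s assms(3) by auto
  have "shape (bump g s)" using addable_diamond[OF r(1,2) s(1) ne] r(3) by simp
  then have 1: "step g c (bump g s)" using stepI[of g s] r s ne by simp
  have eq: "bump g s = bump g' r" using r s ne by auto
  have "step g' b (bump g' r)" using stepI[of g' r] r s ne eq \<open>shape (bump g s)\<close> by simp
  then show thesis using that 1 eq by metis
qed

lemma step_back_diamond:
  assumes "step g b h" "step g' c h" "b \<noteq> c"
  obtains f where "step f c g" "step f b g'"
proof -
  obtain r where r: "shape g" "shape (bump g r)" "h = bump g r" "lab (r, r + g r) = b"
    using assms(1) by (rule stepE)
  obtain s where s: "shape g'" "shape (bump g' s)" "h = bump g' s" "lab (s, s + g' s) = c"
    using assms(2) by (rule stepE)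
  have ne: "r \<noteq> s"
  proof
    assume "r = s"
    then have "g r = g' s" using fun_cong[OF r(3), of r] fun_cong[OF s(3), of s] by simp
    then show False using r s assms(3) \<open>r = s\<close> by simp
  qed
  have "bump g r = bump g' s" using r s by simp
  then obtain f where f: "shape f" "g = bump f s" "g' = bump f r"
    using removable_diamond[OF r(1) s(1) _ r(2) ne] by metis
  have "step f c g" "step f b g'"
    using stepI[of f s] stepI[of f r] f r s ne by auto
  then show thesis using that by blast
qed

lemma step_commute:
  assumes "step f (lab u) g" "step g (lab v) h" "valid u" "valid v"
    and "content v + 2 \<le> content u \<or> content u + 2 \<le> content v"
  shows "\<exists>g'. step f (lab v) g' \<and> step g' (lab u) h"
proof -
  obtain r where r: "shape f" "shape (bump f r)" "g = bump f r" "lab (r, r + f r) = lab u"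
    using assms(1) by (rule stepE)
  obtain s where s: "shape (bump g s)" "h = bump g s" "lab (s, s + g s) = lab v"
    using assms(2) by (rule stepE)
  have c: "f r = content u" "g s = content v"
    using lab_content[OF valid_new[OF r(2)] assms(3) r(4)]
      lab_content[OF valid_new[OF s(1)] assms(4) s(3)] by (simp_all add: content_def)
  then have far: "bump f r s + 2 \<le> f r \<or> f r + 2 \<le> bump f r s" using assms(5) r(3) by simp
  note * = addable_commute[OF r(1,2) s(1)[unfolded r(3)] far]
  have "step f (lab v) (bump f s)" using stepI[OF r(1) *(2)] s(3) r(3) *(1) by simp
  moreover have "step (bump f s) (lab u) h"
  proof -
    have "h = bump (bump f s) r" using s(2) r(3) *(1) by auto
    then show ?thesis using stepI[OF *(2) *(3)] r(4) *(1) by simp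
  qed
  ultimately show ?thesis by blast
qed

section \<open>Subwords and their invariance under moves\<close>

lemma acts_shape: "acts vs D g \<Longrightarrow> shape g"
  by (induction vs arbitrary: g) (auto simp: shape_zero step_def split: if_splits)

lemma acts_cong: "D \<inter> set vs = D' \<inter> set vs \<Longrightarrow> acts vs D g = acts vs D' g"
proof (induction vs arbitrary: g)
  case (Cons v vs)
  have "v \<in> D \<longleftrightarrow> v \<in> D'" using Cons.prems by auto
  moreover have "acts vs D g = acts vs D' g" for g using Cons by auto
  ultimately show ?case by simp
qed simp

text \<open>The cells common to \<open>g\<close> and the shape grown so far always form a shape, so
  reading only the cells of \<open>g\<close> builds the intersection, each cell carrying its own
  label.\<close>

lemma acts_straight:
  assumes "grow vs l" "shape g"
  shows "acts vs (cells g) (\<lambda>i. min (g i) (l i))"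
  using assms(1)
proof (induction rule: grow.induct)
  case (grow_Cons vs f h r)
  let ?m = "\<lambda>i. min (g i) (f i)" and ?m' = "\<lambda>i. min (g i) (h i)"
  show ?case
  proof (cases "(r, r + f r) \<in> cells g")
    case True
    then have "f r < g r" by (simp add: cells_def)
    then have "?m' = bump ?m r" using grow_Cons.hyps by auto
    moreover have "shape ?m" "shape ?m'"
      using shape_min[OF assms(2) grow_shape[OF grow_Cons.hyps(1)]] shape_min[OF assms(2) grow_Cons.hyps(2)]
      by simp_all
    ultimately have "step ?m (lab (r, r + f r)) ?m'"
      using stepI[of ?m r] \<open>f r < g r\<close> by (simp add: min_def)
    then show ?thesis using True grow_Cons.IH by auto
  next
    case False
    then have "?m' = ?m" using grow_Cons.hyps by (auto simp: cells_def min_def)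
    then show ?thesis using False grow_Cons.IH by simp
  qed
qed simp

text \<open>Every cell below \<open>u\<close> is inserted before \<open>u\<close>. The letters of
  \<open>D\<close> inserted after \<open>u\<close> are thus not below it, hence commute with it, and
  the letter of \<open>u\<close> can be postponed to the very end.\<close>

lemma acts_last:
  assumes "grow vs l" "u \<in> set vs" "u \<in> D" "D \<subseteq> cells l"
    and "\<And>y. y \<in> D \<Longrightarrow> \<not> below y u \<Longrightarrow> content y + 2 \<le> content u \<or> content u + 2 \<le> content y"
  shows "acts vs D g \<longleftrightarrow> (\<exists>f. acts vs (D - {u}) f \<and> step f (lab u) g)"
  using assms
proof (induction arbitrary: g D rule: grow.induct)
  case (grow_Cons vs f h r)
  let ?v = "(r, r + f r)"
  have sv: "set vs = cells f" using grow_set grow_Cons.hyps by blast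
  have vn: "?v \<notin> set vs" using sv new_cell_notin by simp
  have sf: "shape f" using grow_Cons.hyps grow_shape by blast
  show ?case
  proof (cases "u = ?v")
    case True
    have "acts vs D = acts vs (D - {u})" using vn True by (intro ext acts_cong) auto
    then show ?thesis using True grow_Cons.prems by simp
  next
    case False
    then have u: "u \<in> set vs" using grow_Cons.prems by simp
    have vu: "valid u" using u sv sf cells_valid by blast
    have vv: "valid ?v" using valid_new grow_Cons.hyps by simp
    have nb: "\<not> below ?v u" using cells_down[OF sf _ vv] u sv new_cell_notin by metis
    have "acts vs D = acts vs (D \<inter> set vs)" by (intro ext acts_cong) auto
    moreover have "acts vs (D - {u}) = acts vs (D \<inter> set vs - {u})" by (intro ext acts_cong) auto
    ultimately have IH: "acts vs D g \<longleftrightarrow> (\<exists>f. acts vs (D - {u}) f \<and> step f (lab u) g)" for g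
      using grow_Cons.IH[OF u, of "D \<inter> set vs" g] grow_Cons.prems sv u by auto
    show ?thesis
    proof (cases "?v \<in> D")
      case False
      then show ?thesis using IH by simp
    next
      case True
      then have "content ?v + 2 \<le> content u \<or> content u + 2 \<le> content ?v"
        using grow_Cons.prems(4)[OF _ nb] by blast
      then have comm: "(\<exists>b. step a (lab u) b \<and> step b (lab ?v) c) \<longleftrightarrow>
          (\<exists>b. step a (lab ?v) b \<and> step b (lab u) c)" for a c
        using step_commute[of a u _ ?v c] step_commute[of a ?v _ u c] vu vv by blast
      have "acts (?v # vs) D g \<longleftrightarrow>
          (\<exists>a. acts vs (D - {u}) a \<and> (\<exists>b. step a (lab u) b \<and> step b (lab ?v) g))"
        using True IH by auto
      also have "\<dots> \<longleftrightarrow> (\<exists>a. acts vs (D - {u}) a \<and> (\<exists>b. step a (lab ?v) b \<and> step b (lab u) g))"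
        unfolding comm ..
      also have "\<dots> \<longleftrightarrow> (\<exists>f. acts (?v # vs) (D - {u}) f \<and> step f (lab u) g)"
        using True False by auto
      finally show ?thesis .
    qed
  qed
qed simp

text \<open>Look at the stage when \<open>nxt u\<close> is inserted. The letter of \<open>u\<close>
  can be postponed to that moment by \<open>acts_last\<close>, and \<open>nxt u\<close> has the same
  label, so the subword builds the same shape with either cell. Later letters are the same for both
  diagrams.\<close>

lemma move_acts:
  assumes "grow vs l" "move (cells l) D D'"
  shows "acts vs D g = acts vs D' g"
  using assms
proof (induction arbitrary: g D D' rule: grow.induct)
  case grow_Nil
  then show ?case by (auto simp: move_def cells_def)
next
  case (grow_Cons vs f h r)
  let ?v = "(r, r + f r)"
  have sv: "set vs = cells f" using grow_set grow_Cons.hyps by blast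
  have vn: "?v \<notin> cells f" using new_cell_notin by simp
  have sf: "shape f" using grow_Cons.hyps grow_shape by blast
  have ch: "cells h = insert ?v (cells f)" using grow_Cons.hyps cells_bump by metis
  obtain u where u: "D \<subseteq> cells h" "u \<in> D" "nxt u \<in> cells h" "blk u \<inter> D = {}"
    "D' = insert (nxt u) (D - {u})" using grow_Cons.prems unfolding move_def by blast
  have vu: "valid u" using u cells_valid grow_Cons.hyps by blast
  have uf: "u \<in> cells f"
  proof (rule ccontr)
    assume "u \<notin> cells f"
    then have "u = ?v" using u ch by auto
    then have "nxt u \<in> cells f" using u ch nxt_above[OF vu] by auto
    then have "u \<in> cells f" using cells_down[OF sf _ vu] nxt_above[OF vu] by blast
    then show False using \<open>u \<notin> cells f\<close> by simp
  qed
  then have uv: "u \<noteq> ?v" using vn by auto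
  show ?case
  proof (cases "nxt u = ?v")
    case False
    then have nf: "nxt u \<in> cells f" using u ch by auto
    have "move (cells f) (D - {?v}) (D' - {?v})"
      unfolding move_def using u uf uv nf ch False by (intro conjI bexI[of _ u]) auto
    note IH = grow_Cons.IH[OF this]
    have "acts vs D = acts vs (D - {?v})" using sv vn by (intro ext acts_cong) auto
    moreover have "acts vs D' = acts vs (D' - {?v})" using sv vn by (intro ext acts_cong) auto
    ultimately have "acts vs D = acts vs D'" using IH by auto
    moreover have "?v \<in> D \<longleftrightarrow> ?v \<in> D'" using u False uv by auto
    ultimately show ?thesis by simp
  next
    case True
    have vD: "?v \<notin> D" using u nxt_blk[OF vu] True by auto
    have "D \<subseteq> cells f" using u ch vD by auto
    have far: "content y + 2 \<le> content u \<or> content u + 2 \<le> content y"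
      if "y \<in> D" "\<not> below y u" for y
    proof (rule blk_far[OF vu _ that(2)])
      show vy: "valid y" using that u cells_valid grow_Cons.hyps by blast
      show "y \<notin> blk u" using u that by auto
      \<comment> \<open>Otherwise the cell inserted last would lie under a cell of the earlier shape
        and so belong to it.\<close>
      show "\<not> below (nxt u) y"
        using cells_down[OF sf _ nxt_valid[OF vu], of y] that \<open>D \<subseteq> cells f\<close> True vn by auto
    qed
    have "acts vs D g \<longleftrightarrow> (\<exists>f. acts vs (D - {u}) f \<and> step f (lab u) g)"
      using acts_last[OF grow_Cons.hyps(1) _ u(2) \<open>D \<subseteq> cells f\<close> far] uf sv by auto
    moreover have "acts vs D' = acts vs (D - {u})"
      using u True vn sv by (intro ext acts_cong) auto
    ultimately show ?thesis using vD u True nxt_lab[OF vu] by simp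
  qed
qed

section \<open>From subwords back to excited moves\<close>

lemma move_mono: "S \<subseteq> S' \<Longrightarrow> move S D D' \<Longrightarrow> move S' D D'"
  unfolding move_def by blast

lemma excited_mono: "S \<subseteq> S' \<Longrightarrow> excited S T \<subseteq> excited S' T"
  unfolding excited_def by (auto intro: rtranclp_mono[THEN predicate2D, rotated] move_mono)

text \<open>Blocking cells lie below \<open>nxt u\<close>, hence inside the shape \<open>f\<close>,
  so a cell outside \<open>f\<close> cannot obstruct the move.\<close>

lemma move_insert:
  assumes sf: "shape f" and vn: "v \<notin> cells f" "valid v" and m: "move (cells f) D D'"
  shows "move (insert v (cells f)) (insert v D) (insert v D')"
proof -
  obtain u where u: "D \<subseteq> cells f" "u \<in> D" "nxt u \<in> cells f" "blk u \<inter> D = {}"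
    "D' = insert (nxt u) (D - {u})" using m unfolding move_def by blast
  have vu: "valid u" using u cells_valid sf by blast
  have "v \<notin> blk u" using cells_down[OF sf u(3) vn(2)] blk_below[OF vu] vn by blast
  then show ?thesis unfolding move_def using u vn by (intro conjI bexI[of _ u]) auto
qed

lemma nxt_pow_above:
  "valid u \<Longrightarrow> valid ((nxt ^^ m) u) \<and> below u ((nxt ^^ m) u)"
proof (induction m)
  case (Suc m)
  then show ?case using nxt_valid nxt_above(1)[of "(nxt ^^ m) u"] by (auto simp: below_def)
qed (simp add: below_def)

text \<open>Along the slide every obstruction would lie above \<open>w\<close>, and the order ideal
  \<open>k\<close>, which does not contain \<open>w\<close>, has no such cell.\<close>

lemma slide:
  assumes sh: "shape h" and sk: "shape k" and kh: "cells k \<subseteq> cells h"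
    and w: "valid w" "w \<notin> cells k"
    and v: "(nxt ^^ m) w \<in> cells h"
  shows "(move (cells h))\<^sup>*\<^sup>* (insert w (cells k)) (insert ((nxt ^^ m) w) (cells k))"
  using v
proof (induction m)
  case (Suc m)
  let ?u = "(nxt ^^ m) w"
  have vu: "valid ?u" and wu: "below w ?u" using nxt_pow_above[OF w(1)] by auto
  have uh: "?u \<in> cells h" using cells_down[OF sh Suc.prems vu] nxt_above[OF vu] by simp
  have nk: "y \<notin> cells k" if "below w y" for y
    using cells_down[OF sk _ w(1) that] w(2) by blast
  have "y \<notin> cells k \<and> y \<noteq> ?u" if "y \<in> blk ?u" for y
    using blk_above[OF vu that] wu nk[of y] unfolding below_def by auto
  then have "blk ?u \<inter> insert ?u (cells k) = {}" by blast
  moreover have "insert (nxt ?u) (cells k) = insert (nxt ?u) (insert ?u (cells k) - {?u})"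
    using nk[OF wu] by auto
  ultimately have "move (cells h) (insert ?u (cells k)) (insert (nxt ?u) (cells k))"
    using uh kh Suc.prems unfolding move_def by (intro conjI bexI[of _ ?u]) auto
  then show ?case using Suc.IH[OF uh] by simp
qed simp

text \<open>Either no move is made and \<open>T\<close> is \<open>D\<close>, or the first move
  already requires its source to lie in \<open>S\<close>.\<close>

lemma excited_imp_subset: "D \<in> excited S T \<Longrightarrow> T \<subseteq> S"
  unfolding excited_def mem_Collect_eq
  by (elim conjE, erule converse_rtranclpE) (auto simp: move_def)

text \<open>One inclusion is invariance under moves. For the other, the letter inserted last
  enlarges some \<open>k\<close> to \<open>g\<close> by a cell \<open>?w\<close> of the same label.
  That cell is slid to its place in \<open>D\<close>, and the remaining cells follow by
  induction.\<close>

theorem excited_iff_acts: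
  assumes "grow vs l" "shape g"
  shows "excited (cells l) (cells g) = {D. D \<subseteq> cells l \<and> acts vs D g}"
proof (intro equalityI subsetI)
  fix D assume D: "D \<in> excited (cells l) (cells g)"
  then have r: "(move (cells l))\<^sup>*\<^sup>* (cells g) D" and sub: "D \<subseteq> cells l"
    by (auto simp: excited_def)
  have "cells g \<subseteq> cells l" using D by (rule excited_imp_subset)
  then have "(\<lambda>i. min (g i) (l i)) = g" by (auto simp: cells_mono_iff min_def)
  then have "acts vs (cells g) g" using acts_straight[OF assms] by simp
  with r have "acts vs D g"
    by (induction rule: rtranclp_induct) (use move_acts[OF assms(1)] in auto)
  then show "D \<in> {D. D \<subseteq> cells l \<and> acts vs D g}" using sub by simp
next
  fix D assume "D \<in> {D. D \<subseteq> cells l \<and> acts vs D g}"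
  then have "D \<subseteq> cells l" "acts vs D g" by auto
  with assms show "D \<in> excited (cells l) (cells g)"
  proof (induction arbitrary: g D rule: grow.induct)
    case grow_Nil
    then show ?case by (simp add: excited_def cells_zero)
  next
    case (grow_Cons vs f h r)
    let ?v = "(r, r + f r)"
    have sv: "set vs = cells f" using grow_set grow_Cons.hyps by blast
    have vn: "?v \<notin> cells f" using new_cell_notin by simp
    have sf: "shape f" using grow_Cons.hyps grow_shape by blast
    have ch: "cells h = insert ?v (cells f)" using grow_Cons.hyps cells_bump by metis
    have vv: "valid ?v" using valid_new grow_Cons.hyps by simp
    show ?case
    proof (cases "?v \<in> D")
      case False
      moreover from this have "D \<subseteq> cells f" using grow_Cons.prems(2) unfolding ch by blast
      ultimately have "D \<in> excited (cells f) (cells g)" using grow_Cons.IH grow_Cons.prems by simp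
      then show ?thesis using excited_mono[of "cells f" "cells h"] ch by blast
    next
      case True
      then obtain k where k: "acts vs D k" "step k (lab ?v) g" using grow_Cons.prems by auto
      let ?D = "D - {?v}"
      have "?D \<subseteq> cells f" using grow_Cons.prems(2) unfolding ch by blast
      have "acts vs ?D = acts vs D" using vn sv by (intro ext acts_cong) auto
      then have Dk: "?D \<in> excited (cells f) (cells k)"
        using grow_Cons.IH[of k ?D] k(1) acts_shape \<open>?D \<subseteq> cells f\<close> by simp
      then have r: "(move (cells f))\<^sup>*\<^sup>* (cells k) ?D" and sub: "?D \<subseteq> cells f"
        by (auto simp: excited_def)
      have kf: "cells k \<subseteq> cells f" using Dk by (rule excited_imp_subset)
      from r have lift: "(move (cells h))\<^sup>*\<^sup>* (insert ?v (cells k)) (insert ?v ?D)"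
        unfolding ch
      proof (induction rule: rtranclp_induct)
        case (step y z)
        then show ?case using move_insert[OF sf vn vv step(2)] by simp
      qed simp
      obtain s where s: "shape k" "shape (bump k s)" "g = bump k s" "lab (s, s + k s) = lab ?v"
        using k(2) by (rule stepE)
      let ?w = "(s, s + k s)"
      have vw: "valid ?w" using valid_new s by blast
      have cont: "f r = k s" using lab_content[OF vv vw s(4)[symmetric]] by (simp add: content_def)
      \<comment> \<open>The two cells lie on one diagonal. If \<open>?v\<close> came strictly before
        \<open>?w\<close>, then \<open>?v\<close> would be in \<open>g\<close> but different from
        the new cell, hence in \<open>k\<close> and so in \<open>f\<close>.\<close>
      have "s \<le> r"
      proof (rule ccontr)
        assume "\<not> s \<le> r"
        moreover from this have "?v \<in> cells k"
          using cells_down[of g ?w ?v] s vv cells_bump[of k s] cont by (auto simp: below_def)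
        ultimately show False using kf vn by blast
      qed
      then have "below ?w ?v" using cont by (simp add: below_def)
      then obtain m where m: "?v = (nxt ^^ m) ?w" using nxt_chain[OF vw vv s(4)] by blast
      \<comment> \<open>The slide comes first, while the other cells still form the shape
        \<open>k\<close>; the moves of those cells are then replayed with \<open>?v\<close> occupied
        (\<open>lift\<close>).\<close>
      have "(move (cells h))\<^sup>*\<^sup>* (insert ?w (cells k)) (insert ?v (cells k))"
        using slide[OF grow_Cons.hyps(2) s(1) _ vw new_cell_notin, of m] m ch kf by auto
      then have "(move (cells h))\<^sup>*\<^sup>* (cells g) (insert ?v ?D)"
        using lift s(3) cells_bump[of k s] by (auto intro: rtranclp_trans)
      moreover have "insert ?v ?D = D" using True by auto
      ultimately show ?thesis using grow_Cons.prems by (simp add: excited_def)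
    qed
  qed
qed

end

section \<open>The Chevalley formula\<close>

text \<open>
  \<open>x\<close> is a point of the space spanned by the weights; \<open>refl c\<close> is the simple reflection with
  simple root \<open>root c\<close>. Up to the correction \<open>K\<close> (which comes from a fundamental weight with
  infinitely many coordinates), reflecting the weight of a shape adds or removes a cell.
\<close>

locale weighted_type = excited_type lab nxt blk
  for lab :: "cell \<Rightarrow> nat" and nxt :: "cell \<Rightarrow> cell" and blk :: "cell \<Rightarrow> cell set" +
  fixes refl :: "nat \<Rightarrow> (nat \<Rightarrow> 'a::field) \<Rightarrow> nat \<Rightarrow> 'a"
    and root :: "nat \<Rightarrow> (nat \<Rightarrow> 'a) \<Rightarrow> 'a"
    and K :: "nat \<Rightarrow> (nat \<Rightarrow> 'a) \<Rightarrow> 'a"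
    and wt :: "(nat \<Rightarrow> 'a) \<Rightarrow> (nat \<Rightarrow> nat) \<Rightarrow> 'a"
    and hook :: "(nat \<Rightarrow> 'a) \<Rightarrow> (nat \<Rightarrow> nat) \<Rightarrow> cell \<Rightarrow> 'a"
  assumes wt_step: "step f c g \<Longrightarrow> wt x g = wt x f + root c x"
    and refl_up: "step f c g \<Longrightarrow> wt (refl c x) f = wt x g + K c x"
    and refl_down: "step f c g \<Longrightarrow> wt (refl c x) g = wt x f + K c x"
    and refl_fix: "shape f \<Longrightarrow> (\<And>g. \<not> step f c g) \<Longrightarrow> (\<And>g. \<not> step g c f) \<Longrightarrow>
      wt (refl c x) f = wt x f + K c x"
    and hook_old: "shape f \<Longrightarrow> shape (bump f r) \<Longrightarrow> u \<in> cells f \<Longrightarrow>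
      hook x (bump f r) u = hook (refl (lab (r, r + f r)) x) f u"
    and hook_new: "shape f \<Longrightarrow> shape (bump f r) \<Longrightarrow>
      hook x (bump f r) (r, r + f r) = root (lab (r, r + f r)) x"
begin

text \<open>A sum over subwords of products of inversions, as in the AJS-Billey formula: the value
  at the fixed point \<open>l\<close> of the equivariant Schubert class of \<open>g\<close>.\<close>

definition excited_sum :: "(nat \<Rightarrow> 'a) \<Rightarrow> (nat \<Rightarrow> nat) \<Rightarrow> (nat \<Rightarrow> nat) \<Rightarrow> 'a" where
  "excited_sum x l g = (\<Sum>D\<in>excited (cells l) (cells g). \<Prod>u\<in>D. hook x l u)"

definition covers :: "(nat \<Rightarrow> nat) \<Rightarrow> (nat \<Rightarrow> nat) set" where
  "covers g = {h. \<exists>c. step g c h}"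

lemma finite_covers: "finite (covers g)"
proof (cases "shape g")
  case True
  have "covers g \<subseteq> bump g ` {..Suc (len g)}"
  proof
    fix h assume "h \<in> covers g"
    then obtain r where r: "shape (bump g r)" "h = bump g r"
      by (auto simp: covers_def elim: stepE)
    have "r \<le> Suc (len g)"
      using r(1) nonzero_iff_len[OF True] unfolding shape_bump_iff[OF True]
      by (metis Suc_le_mono le_add1 less_nat_zero_code plus_1_eq_Suc)
    then show "h \<in> bump g ` {..Suc (len g)}" using r by auto
  qed
  then show ?thesis by (rule finite_subset) simp
next
  case False
  then have "covers g = {}" by (auto simp: covers_def step_def)
  then show ?thesis by simp
qed

lemma lower_cases: "{f. step f c g} = {} \<or> (\<exists>k. {f. step f c g} = {k})"
  using step_inj by blast

text \<open>Diagrams are split by whether they contain the new cell. Those that do must build a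
  shape from which label \<open>c\<close> leads to \<open>g\<close>; the last sum has at most one
  term, and an empty sum covers the case that there is no such shape.\<close>

lemma excited_sum_bump:
  assumes gl: "grow vs l" and sb: "shape (bump l r)" and sg: "shape g"
  defines "c \<equiv> lab (r, r + l r)"
  shows "excited_sum x (bump l r) g = excited_sum (refl c x) l g +
    root c x * (\<Sum>f | step f c g. excited_sum (refl c x) l f)"
proof -
  let ?v = "(r, r + l r)"
  let ?E = "\<lambda>g. {D. D \<subseteq> cells l \<and> acts vs D g}"
  have sl: "shape l" using gl by (rule grow_shape)
  have vn: "?v \<notin> cells l" by (rule new_cell_notin)
  have sv: "set vs = cells l" using gl by (rule grow_set)
  have gl': "grow (?v # vs) (bump l r)" using grow_Cons[OF gl sb] by simp
  have fin: "finite (?E g)" for g using finite_cells[OF sl] by simp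
  have old: "(\<Prod>u\<in>D. hook x (bump l r) u) = (\<Prod>u\<in>D. hook (refl c x) l u)" if "D \<subseteq> cells l" for D
    using that hook_old[OF sl sb] unfolding c_def by (intro prod.cong) auto
  have ex: "excited_sum (refl c x) l g = (\<Sum>D\<in>?E g. \<Prod>u\<in>D. hook (refl c x) l u)" if "shape g" for g
    unfolding excited_sum_def excited_iff_acts[OF gl that] ..
  have ex': "excited (cells (bump l r)) (cells g) =
      {D. D \<subseteq> insert ?v (cells l) \<and> acts (?v # vs) D g}"
    using excited_iff_acts[OF gl' sg] by (simp only: cells_bump)
  have eqE: "excited (cells (bump l r)) (cells g) =
      ?E g \<union> insert ?v ` (\<Union>f\<in>{f. step f c g}. ?E f)" (is "_ = _ \<union> insert ?v ` ?U")
  proof (intro equalityI subsetI)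
    fix D assume "D \<in> excited (cells (bump l r)) (cells g)"
    then have D: "D \<subseteq> insert ?v (cells l)" "acts (?v # vs) D g"
      unfolding ex' by blast+
    show "D \<in> ?E g \<union> insert ?v ` ?U"
    proof (cases "?v \<in> D")
      case False
      then have "D \<in> ?E g" using D by auto
      then show ?thesis ..
    next
      case True
      then obtain f where f: "acts vs D f" "step f c g" using D(2) unfolding c_def by auto
      have "acts vs (D - {?v}) f" using f(1) vn sv acts_cong[of D vs "D - {?v}"] by auto
      moreover have "D - {?v} \<subseteq> cells l" using D(1) by blast
      ultimately have "D - {?v} \<in> ?U" using f(2) by blast
      moreover have "D = insert ?v (D - {?v})" using True by blast
      ultimately show ?thesis by blast
    qed
  next
    fix D assume "D \<in> ?E g \<union> insert ?v ` ?U"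
    then consider "D \<in> ?E g" | D' f where "D = insert ?v D'" "D' \<in> ?E f" "step f c g" by blast
    then show "D \<in> excited (cells (bump l r)) (cells g)"
      unfolding ex'
    proof cases
      case 1
      then have "?v \<notin> D" using vn by blast
      then show "D \<in> {D. D \<subseteq> insert ?v (cells l) \<and> acts (?v # vs) D g}" using 1 by auto
    next
      case 2
      have "acts vs D f" using 2 vn sv acts_cong[of D vs D'] by auto
      then show "D \<in> {D. D \<subseteq> insert ?v (cells l) \<and> acts (?v # vs) D g}"
        using 2 unfolding c_def by auto
    qed
  qed
  have disj: "?E g \<inter> insert ?v ` ?U = {}" using vn by blast
  have finU: "finite ?U" using lower_cases[of c g] fin by (elim disjE exE) simp_all
  have inj: "inj_on (insert ?v) ?U"
  proof (rule inj_onI)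
    fix D D' assume DD: "D \<in> ?U" "D' \<in> ?U" "insert ?v D = insert ?v D'"
    then have "?v \<notin> D" "?v \<notin> D'" using vn by blast+
    then show "D = D'" using DD(3) insert_ident by metis
  qed
  have "excited_sum x (bump l r) g =
      (\<Sum>D\<in>?E g. \<Prod>u\<in>D. hook x (bump l r) u) + (\<Sum>D\<in>insert ?v ` ?U. \<Prod>u\<in>D. hook x (bump l r) u)"
    unfolding excited_sum_def eqE using fin finU disj by (intro sum.union_disjoint) auto
  also have "(\<Sum>D\<in>?E g. \<Prod>u\<in>D. hook x (bump l r) u) = excited_sum (refl c x) l g"
    unfolding ex[OF sg] by (intro sum.cong old) auto
  also have "(\<Sum>D\<in>insert ?v ` ?U. \<Prod>u\<in>D. hook x (bump l r) u) =
      (\<Sum>D\<in>?U. \<Prod>u\<in>insert ?v D. hook x (bump l r) u)"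
    using sum.reindex[OF inj] by (simp add: o_def)
  also have "\<dots> = (\<Sum>D\<in>?U. root c x * (\<Prod>u\<in>D. hook (refl c x) l u))"
  proof (intro sum.cong refl)
    fix D assume "D \<in> ?U"
    then have D: "D \<subseteq> cells l" by blast
    have "finite D" "?v \<notin> D" using D vn finite_cells[OF sl] finite_subset by blast+
    then show "(\<Prod>u\<in>insert ?v D. hook x (bump l r) u) = root c x * (\<Prod>u\<in>D. hook (refl c x) l u)"
      using old[OF D] hook_new[OF sl sb] unfolding c_def by simp
  qed
  also have "\<dots> = root c x * (\<Sum>D\<in>?U. \<Prod>u\<in>D. hook (refl c x) l u)"
    by (simp add: sum_distrib_left)
  also have "(\<Sum>D\<in>?U. \<Prod>u\<in>D. hook (refl c x) l u) = (\<Sum>f | step f c g. excited_sum (refl c x) l f)"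
  proof (cases "{f. step f c g} = {}")
    case True
    then show ?thesis by simp
  next
    case False
    then obtain k where k: "{f. step f c g} = {k}" using lower_cases by blast
    then have "shape k" by (auto simp: step_def)
    then show ?thesis unfolding k by (simp add: ex)
  qed
  finally show ?thesis .
qed

theorem chevalley:
  assumes "grow vs l" "shape g"
  shows "(wt x l - wt x g) * excited_sum x l g = (\<Sum>h\<in>covers g. excited_sum x l h)"
  using assms
proof (induction arbitrary: g x rule: grow.induct)
  case grow_Nil
  have "excited {} (cells g) = (if g = (\<lambda>_. 0) then {{}} else {})" if "shape g" for g
    using excited_iff_acts[OF grow.grow_Nil that] by (auto simp: cells_zero)
  then have e: "excited_sum x (\<lambda>_. 0) g = (if g = (\<lambda>_. 0) then 1 else 0)" if "shape g" for g
    using that by (simp add: excited_sum_def cells_zero)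
  have "excited_sum x (\<lambda>_. 0) h = 0" if "h \<in> covers g" for h
  proof -
    have "shape h" "h \<noteq> (\<lambda>_. 0)"
      using that by (auto simp: covers_def step_def) (metis fun_upd_same nat.distinct(1))
    then show ?thesis by (simp add: e)
  qed
  then show ?case using e[OF grow_Nil] by simp
next
  case (grow_Cons vs l l' r)
  define c where "c = lab (r, r + l r)"
  define Y where "Y = excited_sum (refl c x) l"
  define P where "P g = (\<Sum>f | step f c g. Y f)" for g
  have sl: "shape l" using grow_Cons.hyps grow_shape by blast
  have "step l c l'" using stepI[OF sl, of r] grow_Cons.hyps unfolding c_def by simp
  then have wl: "wt (refl c x) l = wt x l' + K c x" by (rule refl_up)
  \<comment> \<open>At the reflected point the weight of \<open>l\<close> is that of
    \<open>l'\<close> up to \<open>K\<close>. In each case below the weight of \<open>g\<close>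
    acquires the same \<open>K\<close>, which cancels.\<close>
  have IH: "(wt x l' + K c x - wt (refl c x) g) * Y g = (\<Sum>h\<in>covers g. Y h)" if "shape g" for g
    using grow_Cons.IH[OF that, of "refl c x"] wl unfolding Y_def by simp
  have rec: "excited_sum x l' g = Y g + root c x * P g" if "shape g" for g
    using excited_sum_bump[OF grow_Cons.hyps(1) _ that, of r x] grow_Cons.hyps
    unfolding Y_def P_def c_def by simp
  have "(\<Sum>h\<in>covers g. excited_sum x l' h) = (\<Sum>h\<in>covers g. Y h + root c x * P h)"
    by (intro sum.cong refl rec) (auto simp: covers_def step_def)
  then have rhs: "(\<Sum>h\<in>covers g. excited_sum x l' h) =
      (\<Sum>h\<in>covers g. Y h) + root c x * (\<Sum>h\<in>covers g. P h)"
    by (simp add: sum.distrib sum_distrib_left)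
  have P0: "P g = 0" if "\<And>f. \<not> step f c g" for g
    using that by (simp add: P_def)
  have P1: "P g = Y f" if "step f c g" for f g
  proof -
    have "{f. step f c g} = {f}" using that step_inj by blast
    then show ?thesis by (simp add: P_def)
  qed
  consider (up) h0 where "step g c h0" | (down) k where "step k c g"
    | (stay) "\<And>h. \<not> step g c h" "\<And>k. \<not> step k c g" by blast
  then have "(wt x l' - wt x g) * (Y g + root c x * P g) =
      (\<Sum>h\<in>covers g. Y h) + root c x * (\<Sum>h\<in>covers g. P h)"
  proof cases
    \<comment> \<open>A cover of \<open>g\<close> reached also by label \<open>c\<close> would, by a
      diamond, make \<open>c\<close> removable from \<open>g\<close>. So all terms \<open>P\<close>
      vanish and the hypothesis is the claim.\<close>
    case stay
    have "P h = 0" if hc: "h \<in> covers g" for h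
    proof (rule P0)
      fix f show "\<not> step f c h"
      proof
        assume f: "step f c h"
        obtain b where b: "step g b h" using hc by (auto simp: covers_def)
        then have "b \<noteq> c" using stay by blast
        then show False using step_back_diamond[OF b f] stay by blast
      qed
    qed
    then have "(\<Sum>h\<in>covers g. P h) = 0" by simp
    moreover have "P g = 0" using P0 stay by blast
    ultimately show ?thesis
      using IH[OF grow_Cons.prems] refl_fix[OF grow_Cons.prems stay, of x] by simp
  next
    \<comment> \<open>Only \<open>h0\<close> contributes to the sum of \<open>P\<close>, with
      \<open>P h0 = Y g\<close>. This makes up for the \<open>root c x\<close> by which the
      reflected weight of \<open>g\<close> is too large.\<close>
    case up
    have ng: "\<not> step f c g" for f using step_twice up by blast
    have "P h = 0" if hc: "h \<in> covers g - {h0}" for h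
    proof (rule P0)
      fix f show "\<not> step f c h"
      proof
        assume f: "step f c h"
        obtain b where b: "step g b h" using hc by (auto simp: covers_def)
        then have "b \<noteq> c" using hc step_fun up by blast
        then show False using step_back_diamond[OF b f] ng by blast
      qed
    qed
    moreover have "h0 \<in> covers g" using up by (auto simp: covers_def)
    ultimately have "(\<Sum>h\<in>covers g. P h) = P h0"
      using sum.remove[OF finite_covers, of h0 g P] by simp
    moreover have "P h0 = Y g" using P1[OF up] .
    moreover have "P g = 0" using P0 ng by blast
    ultimately show ?thesis
      using IH[OF grow_Cons.prems] refl_up[OF up, of x] wt_step[OF up, of x]
      by (simp add: algebra_simps)
  next
    \<comment> \<open>Diamonds match pairs of a cover of \<open>g\<close> and its lower neighbour
      along \<open>c\<close> with the covers of \<open>k\<close> other than \<open>g\<close>. The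
      sum of \<open>P\<close> is then known from the hypothesis at \<open>k\<close>, where the
      reflection interchanges the weights of \<open>k\<close> and \<open>g\<close>.\<close>
    case down
    have sk: "shape k" using down by (simp add: step_def)
    let ?Q = "Sigma (covers g) (\<lambda>h. {f. step f c h})"
    have fin: "finite {f. step f c h}" for h using lower_cases[of c h] by auto
    have "snd ` ?Q = covers k - {g}"
    proof (intro equalityI subsetI)
      fix f assume "f \<in> snd ` ?Q"
      then obtain h b where h: "step g b h" "step f c h" by (auto simp: covers_def)
      have ne: "b \<noteq> c" using h step_twice[OF down] by blast
      obtain k' where k': "step k' c g" "step k' b f" using step_back_diamond[OF h ne] .
      then have "k' = k" using step_inj down by blast
      moreover have "f \<noteq> g" using h(2) step_twice[OF down] by blast
      ultimately show "f \<in> covers k - {g}" using k' by (auto simp: covers_def)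
    next
      fix f assume "f \<in> covers k - {g}"
      then obtain b where b: "step k b f" "f \<noteq> g" by (auto simp: covers_def)
      then have "b \<noteq> c" using step_fun down by blast
      then obtain h where "step f c h" "step g b h" using step_diamond[OF b(1) down] by blast
      then have "(h, f) \<in> ?Q" by (auto simp: covers_def)
      then show "f \<in> snd ` ?Q" by force
    qed
    moreover have "inj_on snd ?Q" using step_fun by (auto intro!: inj_onI)
    ultimately have bij: "(\<Sum>(h, f)\<in>?Q. Y f) = (\<Sum>f\<in>covers k - {g}. Y f)"
      using sum.reindex[of snd ?Q Y] by (simp add: o_def case_prod_unfold)
    have "(\<Sum>h\<in>covers g. P h) = (\<Sum>(h, f)\<in>?Q. Y f)"
      unfolding P_def using finite_covers fin by (intro sum.Sigma) auto
    moreover have "g \<in> covers k" using down by (auto simp: covers_def)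
    ultimately have S: "(\<Sum>h\<in>covers g. P h) = (\<Sum>f\<in>covers k. Y f) - Y g"
      unfolding bij using sum.remove[OF finite_covers, of g k Y] by simp
    have k: "(\<Sum>f\<in>covers k. Y f) = (wt x l' - wt x g) * Y k"
      using IH[OF sk] refl_up[OF down, of x] by simp
    have g: "(\<Sum>h\<in>covers g. Y h) = (wt x l' - wt x k) * Y g"
      using IH[OF grow_Cons.prems] refl_down[OF down, of x] by simp
    show ?thesis
      unfolding S P1[OF down] k g wt_step[OF down, of x] by (simp add: algebra_simps)
  qed
  then show ?case unfolding rhs rec[OF grow_Cons.prems] .
qed

end

section \<open>Row lengths and missing row lengths\<close>

definition parts :: "(nat \<Rightarrow> nat) \<Rightarrow> nat set" where
  "parts f = f ` {i. f i \<noteq> 0}"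

text \<open>
  The columns to the right of the last row correspond to the positive row lengths missing from \<open>f\<close>;
  \<open>npart f j\<close> is the one attached to column \<open>j\<close> (and \<open>0\<close> if row \<open>j\<close> is nonempty).
\<close>

definition npart :: "(nat \<Rightarrow> nat) \<Rightarrow> nat \<Rightarrow> nat" where
  "npart f j = j - card {k. k \<le> j \<and> j < k + f k}"

lemma in_parts: "p \<in> parts f \<longleftrightarrow> p \<noteq> 0 \<and> (\<exists>i. f i = p)"
  by (auto simp: parts_def)

lemma finite_parts: "shape f \<Longrightarrow> finite (parts f)"
  by (simp add: parts_def shape_def)

lemma addable_next:
  assumes "shape f" "shape (bump f r)"
  shows "Suc (f r) \<notin> parts f"
proof
  assume "Suc (f r) \<in> parts f"
  then obtain i where i: "f i = Suc (f r)" by (auto simp: in_parts)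
  then have ne: "i \<noteq> r" by auto
  have "bump f r i = bump f r r" "bump f r i \<noteq> 0" using i ne by simp_all
  then show False using shape_inj[OF assms(2)] ne by blast
qed

lemma parts_bump:
  assumes "shape f" "shape (bump f r)"
  shows "parts (bump f r) = insert (Suc (f r)) (parts f - {f r})"
proof (intro set_eqI iffI)
  fix p assume "p \<in> parts (bump f r)"
  then obtain i where i: "bump f r i = p" "p \<noteq> 0" by (auto simp: in_parts)
  show "p \<in> insert (Suc (f r)) (parts f - {f r})"
  proof (cases "i = r")
    case False
    then have "f i = p" using i by simp
    then have "f i \<noteq> f r" using shape_inj[OF assms(1), of i r] i False by blast
    then show ?thesis using \<open>f i = p\<close> i by (auto simp: in_parts)
  qed (use i in simp)
next
  fix p assume "p \<in> insert (Suc (f r)) (parts f - {f r})"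
  then consider "p = Suc (f r)" | i where "f i = p" "p \<noteq> 0" "i \<noteq> r" by (auto simp: in_parts)
  then show "p \<in> parts (bump f r)" by cases (auto simp: in_parts)
qed

lemma addable_zero:
  assumes "shape f" "shape (bump f r)" "f r = 0"
  shows "r = Suc (len f)"
proof -
  have "f (len f) \<noteq> 0" if "len f \<noteq> 0" using nonzero_iff_len[OF assms(1), of "len f"] that by simp
  moreover have "f (Suc (len f)) = 0" using nonzero_iff_len[OF assms(1), of "Suc (len f)"] by auto
  moreover have "len f < r"
    using nonzero_iff_len[OF assms(1), of r] assms(3) bump_pos[OF assms(2)] by auto
  moreover have "f k \<noteq> 0 \<Longrightarrow> k \<le> len f" for k using nonzero_iff_len[OF assms(1)] by auto
  ultimately show ?thesis using iffD1[OF shape_bump_iff[OF assms(1)] assms(2)] assms(3)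
    by (metis Suc_lessI le_less_Suc_eq less_Suc_eq_le less_one not_less not_less_zero nat_less_le)
qed

lemma len_bump:
  assumes "shape f" "shape (bump f r)"
  shows "len (bump f r) = (if f r = 0 then Suc (len f) else len f)"
proof -
  have "{i. bump f r i \<noteq> 0} = insert r {i. f i \<noteq> 0}" by auto
  then show ?thesis using assms(1) by (simp add: len_def shape_def card_insert_if)
qed

lemma addable_exists:
  assumes "shape f" "c = 0 \<or> c \<in> parts f" "Suc c \<notin> parts f"
  obtains r where "shape (bump f r)" "f r = c"
proof -
  have ns: "f k \<noteq> Suc c" for k using assms(3) by (auto simp: in_parts)
  show thesis
  proof (cases "c = 0")
    case True
    let ?r = "Suc (len f)"
    have z: "f ?r = 0" using nonzero_iff_len[OF assms(1), of ?r] by auto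
    have "?r = 1 \<or> (\<exists>k\<ge>1. ?r = Suc k \<and> Suc (f ?r) < f k)"
      using nonzero_iff_len[OF assms(1), of "len f"] ns[of "len f"] z True by (cases "len f") auto
    then show thesis using that z True shape_bump_iff[OF assms(1)] by blast
  next
    case False
    then obtain r where r: "f r = c" using assms(2) by (auto simp: in_parts)
    then have "r \<noteq> 0" using False assms(1) by (auto simp: shape_def intro: Nat.gr0I)
    have "r = 1 \<or> (\<exists>k\<ge>1. r = Suc k \<and> Suc (f r) < f k)"
    proof (cases "r = 1")
      case False
      then obtain k where k: "r = Suc k" "k \<ge> 1" using \<open>r \<noteq> 0\<close> by (cases r) auto
      then have "f r < f k" using assms(1) r \<open>c \<noteq> 0\<close> by (auto simp: shape_def)
      then have "Suc (f r) < f k" using ns[of k] r by simp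
      then show ?thesis using k by blast
    qed simp
    then show thesis using that r shape_bump_iff[OF assms(1)] by blast
  qed
qed

lemma removable_exists:
  assumes "shape f" "Suc c \<in> parts f" "c \<notin> parts f"
  obtains g r where "shape g" "f = bump g r" "g r = c"
proof -
  obtain r where r: "f r = Suc c" using assms(2) by (auto simp: in_parts)
  let ?g = "f(r := c)"
  have nc: "f k \<noteq> c" if "c \<noteq> 0" for k using assms(3) that by (auto simp: in_parts)
  have "shape ?g"
    unfolding shape_def
  proof (intro conjI allI impI)
    show "?g 0 = 0" using assms(1) r by (auto simp: shape_def)
    show "finite {i. ?g i \<noteq> 0}"
      by (rule finite_subset[of _ "{i. f i \<noteq> 0}"]) (use assms r in \<open>auto simp: shape_def split: if_splits\<close>)
    fix i :: nat assume "1 \<le> i"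
    then have "f (Suc i) < f i \<or> f (Suc i) = 0" using assms(1) by (auto simp: shape_def)
    then show "?g (Suc i) < ?g i \<or> ?g (Suc i) = 0"
      using r nc[of "Suc i"] by (cases "c = 0") auto
  qed
  moreover have "f = bump ?g r" using r by auto
  ultimately show thesis using that by (metis fun_upd_same)
qed

lemma sum_two:
  fixes x :: "nat \<Rightarrow> 'a::comm_ring_1"
  assumes "finite P" "c \<noteq> d"
  shows "sum x P = sum x (P - {c, d}) + (if c \<in> P then x c else 0) + (if d \<in> P then x d else 0)"
proof -
  have "sum x P = sum x (P - {c, d}) + sum x (P \<inter> {c, d})"
    using assms by (metis sum.Int_Diff add.commute)
  moreover have "P \<inter> {c, d} = (if c \<in> P then {c} else {}) \<union> (if d \<in> P then {d} else {})" by auto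
  ultimately show ?thesis using assms by auto
qed

section \<open>Columns and the lengths missing from a shape\<close>

lemma column_segment:
  assumes "shape f"
  shows "k \<in> {k. k \<le> j \<and> j < k + f k} \<longleftrightarrow> 1 \<le> k \<and> k \<le> card {k. k \<le> j \<and> j < k + f k}"
proof (rule initial_segment)
  show "0 \<notin> {k. k \<le> j \<and> j < k + f k}" using assms by (simp add: shape_def)
  fix k i assume "k \<in> {k. k \<le> j \<and> j < k + f k}" "1 \<le> i" "i \<le> k"
  then show "i \<in> {k. k \<le> j \<and> j < k + f k}"
    using shape_diff[OF assms, of i k] by fastforce
qed simp

lemma npart_pos:
  assumes "shape f" "f j = 0" "1 \<le> j"
  shows "1 \<le> npart f j"
proof -
  have "{k. k \<le> j \<and> j < k + f k} \<subseteq> {1..<j}"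
  proof
    fix k assume "k \<in> {k. k \<le> j \<and> j < k + f k}"
    then show "k \<in> {1..<j}" using assms by (cases "k = 0"; cases "k = j") (auto simp: shape_def)
  qed
  then have "card {k. k \<le> j \<and> j < k + f k} \<le> j - 1"
    using card_mono[of "{1..<j}"] by simp
  then show ?thesis using assms(3) by (simp add: npart_def)
qed

text \<open>Let s be the number of cells in column j. A row k of length j - s would reach column j
  exactly when k > s, but the rows reaching it are the rows k with 1 \<le> k \<le> s.\<close>

lemma npart_notin:
  assumes "shape f" "f j = 0" "1 \<le> j"
  shows "npart f j \<notin> parts f"
proof
  let ?s = "card {k. k \<le> j \<and> j < k + f k}"
  assume "npart f j \<in> parts f"
  then obtain k where k: "f k = j - ?s" "f k \<noteq> 0" by (auto simp: in_parts npart_def)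
  have k1: "1 \<le> k" using k(2) assms(1) by (auto simp: shape_def Suc_le_eq intro!: Nat.gr0I)
  have "k \<le> j" using shape_mono[OF assms(1), of j k] assms(2,3) k(2) by (metis not_less not_less_zero)
  then show False using column_segment[OF assms(1), of k j] k k1 by auto
qed

lemma npart_bump_other:
  assumes "j \<noteq> r + f r"
  shows "npart (bump f r) j = npart f j"
proof -
  have "{k. k \<le> j \<and> j < k + bump f r k} = {k. k \<le> j \<and> j < k + f k}" using assms by auto
  then show ?thesis by (simp add: npart_def)
qed

lemma addable_column:
  assumes "shape f" "shape (bump f r)"
  shows "{k. k \<le> r + f r \<and> r + f r < k + f k} = {1..<r}"
proof (intro equalityI subsetI)
  fix k assume "k \<in> {1..<r}"
  then obtain k' where k': "r = Suc k'" "Suc (f r) < f k'" "1 \<le> k" "k \<le> k'"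
    using iffD1[OF shape_bump_iff[OF assms(1)] assms(2)] by auto
  then show "k \<in> {k. k \<le> r + f r \<and> r + f r < k + f k}"
    using shape_diff[OF assms(1), of k k'] by auto
next
  fix k assume k: "k \<in> {k. k \<le> r + f r \<and> r + f r < k + f k}"
  then have "f k \<noteq> 0" by auto
  have "k < r"
  proof (rule ccontr)
    assume "\<not> k < r"
    then show False using shape_diff[OF assms(1) bump_pos[OF assms(2)], of k] k by auto
  qed
  moreover have "k \<noteq> 0" using k assms(1) by (auto simp: shape_def intro: Nat.gr0I)
  ultimately show "k \<in> {1..<r}" by simp
qed

text \<open>In the column of the new cell the missing length drops from \<open>f r + 1\<close> to
  \<open>f r\<close>, while row \<open>r\<close> grows the other way. For \<open>f r\<close>
  positive, rows and columns therefore undergo the same transposition.\<close>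

lemma npart_addable:
  assumes "shape f" "shape (bump f r)"
  shows "npart f (r + f r) = Suc (f r)" "npart (bump f r) (r + f r) = f r"
proof -
  have r: "1 \<le> r" using bump_pos assms by blast
  then show "npart f (r + f r) = Suc (f r)" by (simp add: npart_def addable_column[OF assms])
  have "{k. k \<le> r + f r \<and> r + f r < k + bump f r k} =
      insert r {k. k \<le> r + f r \<and> r + f r < k + f k}" by auto
  also have "\<dots> = {1..r}" unfolding addable_column[OF assms] using r by auto
  finally show "npart (bump f r) (r + f r) = f r" by (simp add: npart_def)
qed

definition swap :: "nat \<Rightarrow> nat \<Rightarrow> (nat \<Rightarrow> 'a) \<Rightarrow> nat \<Rightarrow> 'a" where
  "swap c d x = (\<lambda>m. if m = c then x d else if m = d then x c else x m)"

text \<open>\<open>neg_swap 1 1\<close> is the sign change of coordinate 1, the extra reflection of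
  type B; \<open>neg_swap 0 1\<close> is the extra one of type D.\<close>

definition neg_swap :: "nat \<Rightarrow> nat \<Rightarrow> (nat \<Rightarrow> 'a::comm_ring_1) \<Rightarrow> nat \<Rightarrow> 'a" where
  "neg_swap c d x = (\<lambda>m. if m = c then - x d else if m = d then - x c else x m)"

text \<open>How the coordinates of a hook change when the cell \<open>(r, r + f r)\<close> is added.\<close>

lemma
  assumes "shape f" "shape (bump f r)"
  shows swap_row: "f r \<noteq> 0 \<Longrightarrow> f i \<noteq> 0 \<Longrightarrow> swap (f r) (Suc (f r)) x (f i) = x (bump f r i)"
    and row_gt_1: "f r = 0 \<Longrightarrow> f i \<noteq> 0 \<Longrightarrow> 1 < f i"
    and swap_npart: "f r \<noteq> 0 \<Longrightarrow> f j = 0 \<Longrightarrow> 1 \<le> j \<Longrightarrow>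
      swap (f r) (Suc (f r)) x (npart f j) = x (npart (bump f r) j)"
    and npart_gt_1: "f r = 0 \<Longrightarrow> f j = 0 \<Longrightarrow> 1 \<le> j \<Longrightarrow> j \<noteq> r \<Longrightarrow> 1 < npart f j"
    and npart_eq: "f r = 0 \<Longrightarrow> j \<noteq> r \<Longrightarrow> npart (bump f r) j = npart f j"
proof -
  have ns: "f k \<noteq> Suc (f r)" for k using addable_next[OF assms] by (auto simp: in_parts)
  show "swap (f r) (Suc (f r)) x (f i) = x (bump f r i)" if "f r \<noteq> 0" "f i \<noteq> 0"
    using that shape_inj[OF assms(1), of i r] ns[of i] by (auto simp: swap_def)
  show "1 < f i" if "f r = 0" "f i \<noteq> 0" using ns[of i] that by simp
  show "swap (f r) (Suc (f r)) x (npart f j) = x (npart (bump f r) j)" if "f r \<noteq> 0" "f j = 0" "1 \<le> j"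
  proof (cases "j = r + f r")
    case True
    then show ?thesis using npart_addable[OF assms] by (simp add: swap_def)
  next
    case False
    have "npart f j \<noteq> f r" using npart_notin[OF assms(1) that(2,3)] that(1) by (auto simp: in_parts)
    have "j \<noteq> r" using that by auto
    then have "npart f j \<noteq> Suc (f r)"
      using npart_notin[OF assms(2), of j] that npart_bump_other[of j r f] False
      by (auto simp: parts_bump[OF assms] split: if_splits)
    then show ?thesis using npart_bump_other[of j r f] False \<open>npart f j \<noteq> f r\<close> by (simp add: swap_def)
  qed
  show eq: "npart (bump f r) j = npart f j" if "f r = 0" "j \<noteq> r"
    using npart_bump_other[of j r f] that by simp
  show "1 < npart f j" if "f r = 0" "f j = 0" "1 \<le> j" "j \<noteq> r"
    using npart_notin[OF assms(2), of j, unfolded parts_bump[OF assms]] npart_pos[OF assms(1), of j] that eq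
    by auto
qed

lemma later_row_zero:
  assumes "shape f" "shape (bump f r)" "r + f r \<le> k" "k \<noteq> r"
  shows "f k = 0"
  using shape_diff[OF assms(1) bump_pos[OF assms(2)], of k] assms(3,4) by fastforce

section \<open>The two types\<close>

subsection \<open>Type B\<close>

definition nxtB :: "cell \<Rightarrow> cell" where
  "nxtB u = (Suc (fst u), Suc (snd u))"

definition blkB :: "cell \<Rightarrow> cell set" where
  "blkB u = {(Suc (fst u), snd u), (fst u, Suc (snd u)), (Suc (fst u), Suc (snd u))}"

lemma nxtB_pow: "(nxtB ^^ m) u = (fst u + m, snd u + m)"
  by (induction m) (simp_all add: nxtB_def)

interpretation exB: excited_type content nxtB blkB
proof
  fix u v :: cell
  assume v: "valid u" "valid v" "content u = content v" "below u v"
  then have "v = (nxtB ^^ (fst v - fst u)) u"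
    unfolding nxtB_pow by (cases u; cases v) (auto simp: valid_def content_def below_def)
  then show "\<exists>m. v = (nxtB ^^ m) u" ..
next
  fix u y :: cell
  assume "valid u" "valid y" "\<not> below y u" "\<not> below (nxtB u) y" "y \<notin> blkB u"
  then show "content y + 2 \<le> content u \<or> content u + 2 \<le> content y"
    by (cases u; cases y) (auto simp: valid_def content_def below_def nxtB_def blkB_def)
qed (auto simp: valid_def content_def below_def nxtB_def blkB_def)

definition reflB :: "nat \<Rightarrow> (nat \<Rightarrow> 'a::comm_ring_1) \<Rightarrow> nat \<Rightarrow> 'a" where
  "reflB c x = (if c = 0 then neg_swap 1 1 x else swap c (Suc c) x)"

definition rootB :: "nat \<Rightarrow> (nat \<Rightarrow> 'a::comm_ring_1) \<Rightarrow> 'a" where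
  "rootB c x = (if c = 0 then x 1 else x (Suc c) - x c)"

definition wtB :: "(nat \<Rightarrow> 'a::comm_ring_1) \<Rightarrow> (nat \<Rightarrow> nat) \<Rightarrow> 'a" where
  "wtB x f = sum x (parts f)"

text \<open>
  Weights and hook lengths are written in the coordinates \<open>x m = z 0 + \<dots> + z (m - 1)\<close> (type D:
  \<open>x m = z 1 + \<dots> + z m\<close>), in which they become \<open>x (f i)\<close> and signed sums of two coordinates.
\<close>

definition coord_hookB :: "(nat \<Rightarrow> 'a::comm_ring_1) \<Rightarrow> (nat \<Rightarrow> nat) \<Rightarrow> cell \<Rightarrow> 'a" where
  "coord_hookB x f u = (case u of (i, j) \<Rightarrow>
     if i = j then x (f i) else if f j \<noteq> 0 then x (f i) + x (f j) else x (f i) - x (npart f j))"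

lemma wtB_split:
  assumes "shape f"
  shows "wtB x f = sum x (parts f - {c, Suc c}) + (if c \<in> parts f then x c else 0) +
    (if Suc c \<in> parts f then x (Suc c) else 0)"
  unfolding wtB_def by (rule sum_two[OF finite_parts[OF assms]]) simp

lemma sum_reflB: "sum (reflB c x) (P - {c, Suc c}) = sum x (P - {c, Suc c})"
  by (intro sum.cong) (auto simp: reflB_def swap_def neg_swap_def)

lemma zero_notin_parts: "0 \<notin> parts f"
  by (simp add: in_parts)

lemma stepB_parts:
  assumes "exB.step f c g"
  shows "shape f" "shape g" "c \<in> parts f \<longleftrightarrow> c \<noteq> 0" "Suc c \<notin> parts f" "c \<notin> parts g"
    "Suc c \<in> parts g" "parts g - {c, Suc c} = parts f - {c, Suc c}"
proof -
  obtain r where r: "shape f" "shape (bump f r)" "g = bump f r" "f r = c"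
    using assms by (rule exB.stepE) (simp add: content_def)
  show "shape f" "shape g" using r by simp_all
  show "c \<in> parts f \<longleftrightarrow> c \<noteq> 0" using r(4) by (auto simp: in_parts)
  show "Suc c \<notin> parts f" using addable_next[OF r(1,2)] r(4) by simp
  show "c \<notin> parts g" "Suc c \<in> parts g" "parts g - {c, Suc c} = parts f - {c, Suc c}"
    using parts_bump[OF r(1,2)] r(3,4) by auto
qed

text \<open>The spin weight has coefficient 1/2 at the parts and -1/2 elsewhere. It differs from
  \<open>wtB\<close> by half the formal sum of all coordinates, which label 0 changes by
  \<open>- x 1\<close> and every other label preserves; this gives the correction term.\<close>

interpretation wB: weighted_type content nxtB blkB reflB rootB
  "\<lambda>c x. if c = 0 then - x 1 else 0" wtB coord_hookB
proof
  fix f c g and x :: "nat \<Rightarrow> 'a"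
  assume "exB.step f c g"
  note * = stepB_parts[OF this]
  show "wtB x g = wtB x f + rootB c x"
    unfolding wtB_split[OF *(1), of x c] wtB_split[OF *(2), of x c]
    using * by (simp add: rootB_def)
  show "wtB (reflB c x) f = wtB x g + (if c = 0 then - x 1 else 0)"
    unfolding wtB_split[OF *(1), of _ c] wtB_split[OF *(2), of _ c] sum_reflB
    using * by (simp add: reflB_def swap_def)
  show "wtB (reflB c x) g = wtB x f + (if c = 0 then - x 1 else 0)"
    unfolding wtB_split[OF *(1), of _ c] wtB_split[OF *(2), of _ c] sum_reflB
    using * by (simp add: reflB_def swap_def neg_swap_def)
next
  fix f c and x :: "nat \<Rightarrow> 'a"
  assume f: "shape f" and up: "\<And>g. \<not> exB.step f c g" and dn: "\<And>g. \<not> exB.step g c f"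
  have 1: "(c = 0 \<or> c \<in> parts f) \<longrightarrow> Suc c \<in> parts f"
  proof (intro impI, rule ccontr)
    assume "c = 0 \<or> c \<in> parts f" "Suc c \<notin> parts f"
    then obtain r where r: "shape (bump f r)" "f r = c" using addable_exists[OF f] by metis
    then show False using exB.stepI[OF f r(1)] up by (simp add: content_def)
  qed
  have 2: "Suc c \<in> parts f \<longrightarrow> c \<in> parts f"
  proof (intro impI, rule ccontr)
    assume "Suc c \<in> parts f" "c \<notin> parts f"
    then obtain g r where r: "shape g" "f = bump g r" "g r = c" using removable_exists[OF f] by metis
    then show False using exB.stepI[of g r] dn f by (simp add: content_def)
  qed
  \<comment> \<open>Label 0 is never idle: a part 1 can be added if absent and removed if
    present.\<close>
  have "c \<noteq> 0" using 1 2 zero_notin_parts by metis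
  then show "wtB (reflB c x) f = wtB x f + (if c = 0 then - x 1 else 0)"
    unfolding wtB_split[OF f, of _ c] sum_reflB using 1 2 by (auto simp: reflB_def swap_def)
next
  fix f r u and x :: "nat \<Rightarrow> 'a"
  assume f: "shape f" "shape (bump f r)" and u: "u \<in> cells f"
  obtain i j where ij: "u = (i, j)" "f i \<noteq> 0" "i \<le> j" "1 \<le> i"
    using cells_valid[OF f(1) u] u by (cases u) (auto simp: cells_def valid_def)
  have lab: "content (r, r + f r) = f r" by (simp add: content_def)
  have "coord_hookB x (bump f r) (i, j) = coord_hookB (reflB (f r) x) f (i, j)"
  proof (cases "f r = 0")
    case True
    then have "i \<noteq> r" using ij(2) by auto
    have [simp]: "f k \<noteq> 0 \<Longrightarrow> f k \<noteq> Suc 0" for k using row_gt_1[OF f True, of k] by simp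
    show ?thesis
    \<comment> \<open>Column \<open>r\<close> changes from the missing length 1 to a row of length
      1, so minus \<open>x 1\<close> becomes plus \<open>x 1\<close>. No other hook involves
      coordinate 1.\<close>
    proof (cases "j = r")
      case True
      then show ?thesis using \<open>f r = 0\<close> \<open>i \<noteq> r\<close> ij npart_addable(1)[OF f]
        by (simp add: coord_hookB_def reflB_def neg_swap_def)
    next
      case False
      have "f j = 0 \<Longrightarrow> npart f j \<noteq> Suc 0" using npart_gt_1[OF f True _ _ False] ij by simp
      then show ?thesis using \<open>f r = 0\<close> False \<open>i \<noteq> r\<close> ij npart_eq[OF f True False]
        by (simp add: coord_hookB_def reflB_def neg_swap_def)
    qed
  next
    case False
    have "f j = 0 \<Longrightarrow> j \<noteq> r" using False by auto
    then show ?thesis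
      using False swap_row[OF f False, of _ x] swap_npart[OF f False, of j x] ij
      by (auto simp: coord_hookB_def reflB_def)
  qed
  then show "coord_hookB x (bump f r) u = coord_hookB (reflB (content (r, r + f r)) x) f u"
    unfolding lab ij(1) .
next
  fix f r and x :: "nat \<Rightarrow> 'a"
  assume f: "shape f" "shape (bump f r)"
  show "coord_hookB x (bump f r) (r, r + f r) = rootB (content (r, r + f r)) x"
    using npart_addable(2)[OF f] later_row_zero[OF f, of "r + f r"]
    by (simp add: coord_hookB_def rootB_def content_def)
qed

subsection \<open>Type D\<close>

text \<open>
  Type D cells are shifted one column to the left, so that both types live on \<open>cells f\<close>. The two
  spin nodes, which the hook formula does not distinguish, alternate along the diagonal.
\<close>

definition labD :: "cell \<Rightarrow> nat" where
  "labD u = (if fst u = snd u then (if odd (fst u) then 0 else 1) else Suc (content u))"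

text \<open>As the labels alternate on the diagonal, the next diagonal cell with the same label is
  two steps away; this is the long excited move of type D.\<close>

definition nxtD :: "cell \<Rightarrow> cell" where
  "nxtD u = (if fst u = snd u then (Suc (Suc (fst u)), Suc (Suc (snd u)))
     else (Suc (fst u), Suc (snd u)))"

definition blkD :: "cell \<Rightarrow> cell set" where
  "blkD u = (let (i, j) = u in if i = j
     then {(i, i + 1), (i, i + 2), (i + 1, i + 1), (i + 1, i + 2), (i + 2, i + 2)}
     else {(i + 1, j), (i, j + 1), (i + 1, j + 1)})"

lemma nxtD_pow:
  "(nxtD ^^ m) u = (if fst u = snd u then (fst u + 2 * m, snd u + 2 * m) else (fst u + m, snd u + m))"
  by (cases u, induction m) (auto simp: nxtD_def)

interpretation exD: excited_type labD nxtD blkD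
proof
  fix u v :: cell
  assume v: "valid u" "valid v" "labD u = labD v" "below u v"
  obtain i j k l where u: "u = (i, j)" and w: "v = (k, l)" by (cases u, cases v)
  show "\<exists>m. v = (nxtD ^^ m) u"
  proof (cases "i = j")
    case True
    have "k = l" using v True u w
      by (auto simp: labD_def content_def valid_def split: if_splits)
    have "odd i \<longleftrightarrow> odd k" using v(3) True \<open>k = l\<close> u w by (simp add: labD_def split: if_splits)
    moreover have "i \<le> k" using v(4) u w by (simp add: below_def)
    ultimately have "even (k - i)" by simp
    then obtain m where "k - i = 2 * m" by (rule evenE)
    then have "v = (nxtD ^^ m) u" unfolding nxtD_pow using True \<open>k = l\<close> \<open>i \<le> k\<close> u w by simp
    then show ?thesis ..
  next
    case False
    then have "v = (nxtD ^^ (k - i)) u" unfolding nxtD_pow using v u w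
      by (auto simp: labD_def content_def valid_def below_def split: if_splits)
    then show ?thesis ..
  qed
next
  fix u y :: cell
  assume y: "valid u" "valid y" "\<not> below y u" "\<not> below (nxtD u) y" "y \<notin> blkD u"
  obtain i j k l where u: "u = (i, j)" and w: "y = (k, l)" by (cases u, cases y)
  show "content y + 2 \<le> content u \<or> content u + 2 \<le> content y"
  proof (cases "i = j")
    case True
    show ?thesis
    proof (rule ccontr)
      assume "\<not> ?thesis"
      \<comment> \<open>A cell close to the diagonal has content 0 or 1. Those that are neither
        below \<open>u\<close> nor above its target all lie in \<open>blkD u\<close>.\<close>
      then have "l = k \<or> l = Suc k" using y True u w by (auto simp: content_def valid_def)
      moreover have "k \<noteq> i \<or> l \<noteq> i" "k \<noteq> i \<or> l \<noteq> Suc i" "k \<noteq> Suc i \<or> l \<noteq> Suc i"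
        "k \<noteq> Suc i \<or> l \<noteq> Suc (Suc i)"
        using y True u w by (auto simp: below_def blkD_def)
      moreover have "k < i \<longrightarrow> i < l" "Suc (Suc i) \<le> k \<longrightarrow> l < Suc (Suc i)" using y True u w
        by (auto simp: below_def nxtD_def)
      moreover have "k = i \<or> k = Suc i \<or> k < i \<or> Suc (Suc i) \<le> k" by linarith
      ultimately show False by presburger
    qed
  next
    case False
    then show ?thesis using y u w
      by (auto simp: valid_def content_def below_def nxtD_def blkD_def)
  qed
qed (auto simp: valid_def content_def below_def nxtD_def blkD_def labD_def split: if_splits)

definition reflD :: "nat \<Rightarrow> (nat \<Rightarrow> 'a::comm_ring_1) \<Rightarrow> nat \<Rightarrow> 'a" where
  "reflD c x = (if c = 0 then neg_swap 0 1 x else swap (c - 1) c x)"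

definition rootD :: "nat \<Rightarrow> (nat \<Rightarrow> 'a::comm_ring_1) \<Rightarrow> 'a" where
  "rootD c x = (if c = 0 then x 0 + x 1 else x c - x (c - 1))"

text \<open>Weights of a half-spin representation have a fixed parity of signs; the coordinate 0 is
  included exactly when this is needed to make the number of elements even.\<close>

definition partsD :: "(nat \<Rightarrow> nat) \<Rightarrow> nat set" where
  "partsD f = (if odd (len f) then insert 0 (parts f) else parts f)"

definition wtD :: "(nat \<Rightarrow> 'a::comm_ring_1) \<Rightarrow> (nat \<Rightarrow> nat) \<Rightarrow> 'a" where
  "wtD x f = sum x (partsD f)"

text \<open>The middle case is the column attached to the last nonempty row. Its \<open>x 0\<close>
  vanishes at the partial sums, but its alternating sign is required for the reflections to act
  correctly.\<close>

definition coord_hookD :: "(nat \<Rightarrow> 'a::comm_ring_1) \<Rightarrow> (nat \<Rightarrow> nat) \<Rightarrow> cell \<Rightarrow> 'a" where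
  "coord_hookD x f u = (case u of (i, j) \<Rightarrow>
     if f (Suc j) \<noteq> 0 then x (f i) + x (f (Suc j))
     else if f j \<noteq> 0 then (if odd j then x (f i) + x 0 else x (f i) - x 0)
     else x (f i) - x (npart f j))"

lemma zero_in_partsD: "0 \<in> partsD f \<longleftrightarrow> odd (len f)"
  by (simp add: partsD_def in_parts)

lemma Suc_in_partsD: "Suc m \<in> partsD f \<longleftrightarrow> Suc m \<in> parts f"
  by (simp add: partsD_def)

text \<open>Truncated subtraction is intended: labels 0 and 1 both affect the coordinates 0 and
  1.\<close>

abbreviation loD :: "nat \<Rightarrow> nat" where "loD c \<equiv> c - 1"
abbreviation hiD :: "nat \<Rightarrow> nat" where "hiD c \<equiv> Suc (c - 1)"

lemma wtD_split:
  assumes "shape f"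
  shows "wtD x f = sum x (partsD f - {loD c, hiD c}) + (if loD c \<in> partsD f then x (loD c) else 0) +
    (if hiD c \<in> partsD f then x (hiD c) else 0)"
  unfolding wtD_def by (rule sum_two) (simp_all add: finite_parts[OF assms] partsD_def)

lemma sum_reflD: "sum (reflD c x) (P - {loD c, hiD c}) = sum x (P - {loD c, hiD c})"
  by (intro sum.cong) (auto simp: reflD_def swap_def neg_swap_def)

lemma labD_new:
  assumes "shape f" "shape (bump f r)"
  shows "labD (r, r + f r) = (if f r = 0 then if odd (len f) then 1 else 0 else Suc (f r))"
  using addable_zero[OF assms] by (cases "f r = 0") (simp_all add: labD_def content_def)

lemma stepD_parts:
  assumes "exD.step f c g"
  shows "shape f" "shape g" "loD c \<in> partsD f \<longleftrightarrow> c \<noteq> 0" "hiD c \<notin> partsD f"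
    "loD c \<in> partsD g \<longleftrightarrow> c = 0" "hiD c \<in> partsD g"
    "partsD g - {loD c, hiD c} = partsD f - {loD c, hiD c}"
proof -
  obtain r where r: "shape f" "shape (bump f r)" "g = bump f r" "labD (r, r + f r) = c"
    using assms by (rule exD.stepE)
  have c: "c = (if f r = 0 then if odd (len f) then 1 else 0 else Suc (f r))"
    using r labD_new by metis
  have p: "parts g = insert (Suc (f r)) (parts f - {f r})" using parts_bump[OF r(1,2)] r(3) by simp
  have l: "len g = (if f r = 0 then Suc (len f) else len f)" using len_bump[OF r(1,2)] r(3) by simp
  have n: "Suc (f r) \<notin> parts f" using addable_next[OF r(1,2)] .
  have fr: "f r \<noteq> 0 \<Longrightarrow> f r \<in> parts f" by (auto simp: in_parts)
  show "shape f" "shape g" using r by simp_all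
  \<comment> \<open>Label 0 adds the coordinates 0 and 1 together, and any other label
    \<open>c\<close> replaces \<open>c - 1\<close> by \<open>c\<close>. A new row does the former if
    the number of rows was even, the latter with \<open>c = 1\<close> if it was odd.\<close>
  have *: "(loD c \<in> partsD f \<longleftrightarrow> c \<noteq> 0) \<and> hiD c \<notin> partsD f \<and>
    partsD g = (if c = 0 then insert 0 (insert 1 (partsD f)) else insert (hiD c) (partsD f - {loD c}))"
  proof (cases "f r = 0")
    case True
    then show ?thesis unfolding c using p l n zero_notin_parts[of f]
      by (cases "odd (len f)") (auto simp: partsD_def)
  next
    case False
    have "partsD g = insert (Suc (f r)) (partsD f - {f r})"
      unfolding partsD_def l p using False by (simp add: insert_Diff_if insert_commute)
    moreover have "c = Suc (f r)" using c False by simp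
    ultimately show ?thesis using n fr False by (simp add: Suc_in_partsD partsD_def[of f])
  qed
  then show "loD c \<in> partsD f \<longleftrightarrow> c \<noteq> 0" "hiD c \<notin> partsD f" by blast+
  have "(loD c \<in> partsD g \<longleftrightarrow> c = 0) \<and> hiD c \<in> partsD g \<and>
    partsD g - {loD c, hiD c} = partsD f - {loD c, hiD c}"
  proof (cases "c = 0")
    case True
    then have g: "partsD g = insert 0 (insert 1 (partsD f))" using * by simp
    show ?thesis unfolding g True by auto
  next
    case False
    then have g: "partsD g = insert (hiD c) (partsD f - {loD c})" using * by simp
    show ?thesis unfolding g using False by auto
  qed
  then show "loD c \<in> partsD g \<longleftrightarrow> c = 0" "hiD c \<in> partsD g"
    "partsD g - {loD c, hiD c} = partsD f - {loD c, hiD c}" by blast+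
qed

text \<open>Label 0 acts whenever its two coordinates are both present or both absent, every other
  label whenever exactly one of them is present; here the label does not act.\<close>

lemma reflD_fix_cases:
  assumes f: "shape f" and up: "\<And>g. \<not> exD.step f c g" and dn: "\<And>g. \<not> exD.step g c f"
  shows "(loD c \<in> partsD f \<longleftrightarrow> hiD c \<in> partsD f) \<longleftrightarrow> c \<noteq> 0"
proof -
  have up': "c \<noteq> (if m = 0 then if odd (len f) then 1 else 0 else Suc m)"
    if m: "m = 0 \<or> m \<in> parts f" "Suc m \<notin> parts f" for m
  proof -
    obtain r where "shape (bump f r)" "f r = m" using addable_exists[OF f m] .
    then show ?thesis using exD.stepI[OF f, of r] up labD_new[OF f, of r] by metis
  qed
  have dn': "c \<noteq> (if m = 0 then if odd (len f) then 0 else 1 else Suc m)"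
    if m: "Suc m \<in> parts f" "m \<notin> parts f" for m
  proof -
    obtain g r where r: "shape g" "f = bump g r" "g r = m" using removable_exists[OF f m] .
    have sb: "shape (bump g r)" using r f by simp
    have "len f = (if m = 0 then Suc (len g) else len g)" using len_bump[OF r(1) sb] r by simp
    moreover have "labD (r, r + g r) \<noteq> c" using exD.stepI[OF r(1) sb] dn r(2) by auto
    ultimately show ?thesis using labD_new[OF r(1) sb] r(3) by (auto split: if_splits)
  qed
  show ?thesis
  proof (cases "c \<le> 1")
    case True
    then have "c = 0 \<or> c = 1" by auto
    then show ?thesis using up'[of 0] dn'[of 0] zero_notin_parts[of f]
      by (cases "Suc 0 \<in> parts f") (auto simp: zero_in_partsD Suc_in_partsD split: if_splits)
  next
    case False
    then obtain m where m: "c = Suc (Suc m)" by (cases c; cases "c - 1") auto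
    then show ?thesis using up'[of "Suc m"] dn'[of "Suc m"]
      by (auto simp: Suc_in_partsD)
  qed
qed

text \<open>As in type B, the correction is the change of half the formal sum of all coordinates,
  here \<open>- (x 0 + x 1)\<close> for label 0.\<close>

interpretation wD: weighted_type labD nxtD blkD reflD rootD
  "\<lambda>c x. if c = 0 then - (x 0 + x 1) else 0" wtD coord_hookD
proof
  fix f c g and x :: "nat \<Rightarrow> 'a"
  assume "exD.step f c g"
  note * = stepD_parts[OF this]
  show "wtD x g = wtD x f + rootD c x"
    unfolding wtD_split[OF *(1), of x c] wtD_split[OF *(2), of x c]
    using * by (simp add: rootD_def)
  show "wtD (reflD c x) f = wtD x g + (if c = 0 then - (x 0 + x 1) else 0)"
    unfolding wtD_split[OF *(1), of _ c] wtD_split[OF *(2), of _ c] sum_reflD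
    using * by (simp add: reflD_def swap_def)
  show "wtD (reflD c x) g = wtD x f + (if c = 0 then - (x 0 + x 1) else 0)"
    unfolding wtD_split[OF *(1), of _ c] wtD_split[OF *(2), of _ c] sum_reflD
    using * by (simp add: reflD_def swap_def neg_swap_def)
next
  fix f c and x :: "nat \<Rightarrow> 'a"
  assume f: "shape f" and "\<And>g. \<not> exD.step f c g" "\<And>g. \<not> exD.step g c f"
  note * = reflD_fix_cases[OF this]
  show "wtD (reflD c x) f = wtD x f + (if c = 0 then - (x 0 + x 1) else 0)"
    unfolding wtD_split[OF f, of _ c] sum_reflD
    using * by (auto simp: reflD_def swap_def neg_swap_def split: if_splits)
next
  fix f r u and x :: "nat \<Rightarrow> 'a"
  assume f: "shape f" "shape (bump f r)" and u: "u \<in> cells f"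
  obtain i j where ij: "u = (i, j)" "f i \<noteq> 0" "i \<le> j" "1 \<le> i"
    using cells_valid[OF f(1) u] u by (cases u) (auto simp: cells_def valid_def)
  have nz: "f k \<noteq> 0 \<longleftrightarrow> 1 \<le> k \<and> k \<le> len f" for k using nonzero_iff_len[OF f(1)] .
  have "coord_hookD x (bump f r) (i, j) = coord_hookD (reflD (labD (r, r + f r)) x) f (i, j)"
  proof (cases "f r = 0")
    case True
    then have ir: "i \<noteq> r" using ij(2) by auto
    have r: "r = Suc (len f)" using addable_zero[OF f True] .
    have row: "f k \<noteq> 0 \<Longrightarrow> f k \<noteq> Suc 0" for k using row_gt_1[OF f True, of k] by simp
    have L: "reflD (labD (r, r + f r)) x = (if odd r then neg_swap 0 1 x else swap 0 1 x)"
      using labD_new[OF f] True r by (auto simp: reflD_def)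
    \<comment> \<open>A new row \<open>r\<close> alters the hooks of columns \<open>r - 1\<close>
      and \<open>r\<close> only. The sign of \<open>x 0\<close> in the middle case of
      \<open>coord_hookD\<close> alternates just as the reflection does with the parity of
      \<open>r\<close>.\<close>
    consider "j < len f" | "j = len f" | "j = r" | "r < j" using r by linarith
    then show ?thesis
    proof cases
      case 1
      then have "f (Suc j) \<noteq> 0" "Suc j \<noteq> r" using nz[of "Suc j"] r by auto
      then show ?thesis unfolding L coord_hookD_def using ir ij row
        by (auto simp: swap_def neg_swap_def)
    next
      case 2
      then have "f j \<noteq> 0" "f (Suc j) = 0" "Suc j = r" using nz[of j] nz[of "Suc j"] ij r by auto
      then show ?thesis unfolding L coord_hookD_def using ir ij row True
        by (auto simp: swap_def neg_swap_def)
    next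
      case 3
      then have "f (Suc j) = 0" "f j = 0" using nz[of j] nz[of "Suc j"] r by auto
      then show ?thesis unfolding L coord_hookD_def using ir ij row True 3 npart_addable(1)[OF f]
        by (auto simp: swap_def neg_swap_def)
    next
      case 4
      then have "f (Suc j) = 0" "f j = 0" "j \<noteq> r" "Suc j \<noteq> r"
        using nz[of j] nz[of "Suc j"] r by auto
      moreover have "1 < npart f j" using npart_gt_1[OF f True, of j] calculation ij by simp
      ultimately show ?thesis unfolding L coord_hookD_def using ir ij row True npart_eq[OF f True, of j]
        by (auto simp: swap_def neg_swap_def)
    qed
  next
    case False
    then have L: "reflD (labD (r, r + f r)) x = swap (f r) (Suc (f r)) x"
      using labD_new[OF f] by (auto simp: reflD_def)
    have b: "bump f r k = 0 \<longleftrightarrow> f k = 0" for k using False by simp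
    have z: "swap (f r) (Suc (f r)) x 0 = x 0" using False by (simp add: swap_def)
    show ?thesis unfolding L coord_hookD_def prod.case b z
      using swap_row[OF f False, of _ x] swap_npart[OF f False, of j x] ij
      by (simp del: fun_upd_apply)
  qed
  then show "coord_hookD x (bump f r) u = coord_hookD (reflD (labD (r, r + f r)) x) f u"
    unfolding ij(1) .
next
  fix f r and x :: "nat \<Rightarrow> 'a"
  assume f: "shape f" "shape (bump f r)"
  have z: "f (Suc (r + f r)) = 0" using later_row_zero[OF f, of "Suc (r + f r)"] by simp
  have "f r = 0 \<Longrightarrow> len f = r - 1 \<and> 1 \<le> r" using addable_zero[OF f] by simp
  then show "coord_hookD x (bump f r) (r, r + f r) = rootD (labD (r, r + f r)) x"
    using z npart_addable(2)[OF f] later_row_zero[OF f, of "r + f r"]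
    unfolding labD_new[OF f] by (auto simp: coord_hookD_def rootD_def)
qed

section \<open>Tableaux\<close>

definition before :: "cell \<Rightarrow> cell \<Rightarrow> bool" where
  "before u v \<longleftrightarrow> (fst u = fst v \<and> snd u < snd v) \<or> (snd u = snd v \<and> fst u < fst v)"

text \<open>Tableaux read off by increasing entries. \<open>sorted_wrt\<close> compares all pairs of
  positions, which suits the non-transitive relation \<open>before\<close>.\<close>

definition linexts :: "cell set \<Rightarrow> cell list set" where
  "linexts A = {us. distinct us \<and> set us = A \<and> sorted_wrt (\<lambda>u v. \<not> before v u) us}"

definition minimal :: "cell set \<Rightarrow> cell set" where
  "minimal A = {u \<in> A. \<forall>v\<in>A. \<not> before v u}"

fun lweight :: "(cell \<Rightarrow> 'a::field) \<Rightarrow> cell list \<Rightarrow> 'a" where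
  "lweight w [] = 1"
| "lweight w (u # us) = 1 / (\<Sum>v\<leftarrow>u # us. w v) * lweight w us"

definition tableaux :: "cell set \<Rightarrow> (cell \<Rightarrow> nat) set" where
  "tableaux A = {T \<in> extensional A. bij_betw T A {1..card A} \<and>
     (\<forall>u\<in>A. \<forall>v\<in>A. before u v \<longrightarrow> T u < T v)}"

lemma finite_linexts: "finite A \<Longrightarrow> finite (linexts A)"
  by (rule finite_subset[OF _ finite_subset_distinct]) (auto simp: linexts_def)

lemma linexts_empty: "linexts {} = {[]}"
  by (auto simp: linexts_def)

lemma linexts_Cons:
  assumes "A \<noteq> {}"
  shows "linexts A = (\<Union>u\<in>minimal A. (#) u ` linexts (A - {u}))"
proof (intro equalityI subsetI)
  fix us assume us: "us \<in> linexts A"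
  then obtain u vs where uv: "us = u # vs" using assms by (cases us) (auto simp: linexts_def)
  have "\<not> before u u" by (simp add: before_def)
  then have "u \<in> minimal A" "vs \<in> linexts (A - {u})"
    using us unfolding uv linexts_def minimal_def by auto
  then show "us \<in> (\<Union>u\<in>minimal A. (#) u ` linexts (A - {u}))" using uv by blast
qed (auto simp: linexts_def minimal_def)

text \<open>The factor of the first cell is the inverse of the total weight, whichever cell comes
  first, so it can be taken out of the sum.\<close>

lemma sum_linexts:
  assumes "finite A" "A \<noteq> {}"
  shows "(\<Sum>us\<in>linexts A. lweight w us) =
    1 / sum w A * (\<Sum>u\<in>minimal A. \<Sum>us\<in>linexts (A - {u}). lweight w us)"
proof -
  have fm: "finite (minimal A)" using assms(1) by (simp add: minimal_def)
  have "(\<Sum>us\<in>linexts A. lweight w us) =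
      (\<Sum>u\<in>minimal A. \<Sum>us\<in>(#) u ` linexts (A - {u}). lweight w us)"
    unfolding linexts_Cons[OF assms(2)]
    by (rule sum.UNION_disjoint) (use fm assms(1) finite_linexts in auto)
  also have "\<dots> = (\<Sum>u\<in>minimal A. 1 / sum w A * (\<Sum>us\<in>linexts (A - {u}). lweight w us))"
  proof (intro sum.cong refl)
    fix u assume "u \<in> minimal A"
    then have u: "u \<in> A" by (simp add: minimal_def)
    have "(\<Sum>us\<in>(#) u ` linexts (A - {u}). lweight w us) = (\<Sum>us\<in>linexts (A - {u}). lweight w (u # us))"
      by (subst sum.reindex) auto
    also have "\<dots> = (\<Sum>us\<in>linexts (A - {u}). 1 / sum w A * lweight w us)"
    proof (intro sum.cong refl)
      fix us assume us: "us \<in> linexts (A - {u})"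
      then have "distinct (u # us)" "set (u # us) = A" using u by (auto simp: linexts_def)
      then have "(\<Sum>v\<leftarrow>u # us. w v) = sum w A" using sum_list_distinct_conv_sum_set by metis
      then show "lweight w (u # us) = 1 / sum w A * lweight w us" by simp
    qed
    finally show "(\<Sum>us\<in>(#) u ` linexts (A - {u}). lweight w us) =
        1 / sum w A * (\<Sum>us\<in>linexts (A - {u}). lweight w us)" by (simp add: sum_distrib_left)
  qed
  finally show ?thesis by (simp add: sum_distrib_left)
qed

lemma lweight_map:
  "a \<le> b \<Longrightarrow> lweight w (map q [a..<b]) = (\<Prod>k = a..<b. 1 / (\<Sum>m = k..<b. w (q m)))"
proof (induction a rule: inc_induct)
  case (step a)
  have "(\<Sum>v\<leftarrow>map q [a..<b]. w v) = (\<Sum>m = a..<b. w (q m))"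
    by (simp add: interv_sum_list_conv_sum_set_nat o_def)
  moreover have "[a..<b] = a # [Suc a..<b]" using step.hyps by (simp add: upt_conv_Cons)
  ultimately have "lweight w (map q [a..<b]) =
      1 / (\<Sum>m = a..<b. w (q m)) * lweight w (map q [Suc a..<b])" by simp
  then show ?case using step by (simp add: prod.atLeast_Suc_lessThan)
qed simp

lemma tableaux_bij:
  assumes "finite A"
  shows "bij_betw (\<lambda>T. map (inv_into A T) [1..<Suc (card A)]) (tableaux A) (linexts A)"
    (is "bij_betw ?F _ _")
proof (intro bij_betwI')
  let ?n = "card A"
  {
    fix T T' assume T: "T \<in> tableaux A" and T': "T' \<in> tableaux A"
    show "?F T = ?F T' \<longleftrightarrow> T = T'"
    proof
      assume eq: "?F T = ?F T'"
      have b: "bij_betw T A {1..?n}" "bij_betw T' A {1..?n}" using T T' by (auto simp: tableaux_def)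
      show "T = T'"
      proof (rule extensionalityI[of T A])
        fix u assume u: "u \<in> A"
        then have k: "T u \<in> {1..?n}" using b by (auto simp: bij_betw_def)
        have "inv_into A T' k = inv_into A T k" if "k \<in> {1..?n}" for k
          using eq that unfolding map_eq_conv by (simp del: upt_Suc)
        then have "inv_into A T' (T u) = inv_into A T (T u)" using k .
        also have "\<dots> = u" using b u by (simp add: bij_betw_def)
        finally show "T u = T' u" using k b(2) by (metis bij_betw_def f_inv_into_f)
      qed (use T T' in \<open>auto simp: tableaux_def\<close>)
    qed simp
  next
    fix T assume T: "T \<in> tableaux A"
    then have b: "bij_betw T A {1..?n}" by (auto simp: tableaux_def)
    have bi: "bij_betw (inv_into A T) {1..?n} A" using b by (rule bij_betw_inv_into)
    have s: "set [1..<Suc ?n] = {1..?n}" by auto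
    have "sorted_wrt (\<lambda>i j. \<not> before (inv_into A T j) (inv_into A T i)) [1..<Suc ?n]"
    proof (rule sorted_wrt_mono_rel[OF _ sorted_wrt_upt])
      fix i j assume ij: "i \<in> set [1..<Suc ?n]" "j \<in> set [1..<Suc ?n]" "i < j"
      have "inv_into A T i \<in> A" "inv_into A T j \<in> A" "T (inv_into A T i) = i" "T (inv_into A T j) = j"
        using ij bi b by (auto simp: bij_betw_def f_inv_into_f)
      then show "\<not> before (inv_into A T j) (inv_into A T i)"
        using T ij(3) unfolding tableaux_def by fastforce
    qed
    then show "?F T \<in> linexts A"
      using bi s by (simp add: linexts_def distinct_map sorted_wrt_map bij_betw_def del: upt_Suc)
  next
    fix us assume us: "us \<in> linexts A"
    define p where "p k = us ! (k - 1)" for k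
    have n: "length us = ?n" using us distinct_card[of us] by (simp add: linexts_def)
    have us_p: "us = map p [1..<Suc ?n]" by (rule nth_equalityI) (simp_all add: n p_def del: upt_Suc)
    have "inj_on p {1..?n}"
      using us n by (auto simp: linexts_def p_def inj_on_def nth_eq_iff_index_eq)
    moreover have "p ` {1..?n} = A"
    proof -
      have "set us = p ` {1..?n}" by (subst us_p) auto
      then show ?thesis using us by (simp add: linexts_def)
    qed
    ultimately have bp: "bij_betw p {1..?n} A" by (simp add: bij_betw_def)
    define T where "T = restrict (inv_into {1..?n} p) A"
    have bT: "bij_betw T A {1..?n}"
      using bij_betw_inv_into[OF bp] by (simp add: T_def cong: bij_betw_cong)
    have Tp: "T (p k) = k" if "k \<in> {1..?n}" for k
      using that bp by (auto simp: T_def bij_betw_def)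
    have "before u v \<longrightarrow> T u < T v" if uv: "u \<in> A" "v \<in> A" for u v
    proof
      assume bf: "before u v"
      obtain a b where ab: "a \<in> {1..?n}" "u = p a" "b \<in> {1..?n}" "v = p b"
        using uv bp unfolding bij_betw_def by blast
      have "\<not> b < a"
      proof
        assume "b < a"
        then have "\<not> before (us ! (a - 1)) (us ! (b - 1))"
          using us ab n by (auto simp: linexts_def sorted_wrt_iff_nth_less)
        then show False using bf ab by (simp add: p_def)
      qed
      moreover have "a \<noteq> b" using bf ab by (auto simp: before_def)
      ultimately show "T u < T v" using Tp ab by simp
    qed
    then have "T \<in> tableaux A" using bT by (simp add: tableaux_def T_def)
    moreover have "inv_into A T k = p k" if "k \<in> {1..?n}" for k
      using that Tp bT bp by (intro inv_into_f_eq) (auto simp: bij_betw_def)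
    then have "?F T = us" by (subst us_p) auto
    ultimately show "\<exists>T\<in>tableaux A. us = ?F T" by blast
  }
qed

lemma sum_tableaux:
  assumes "finite A"
  shows "(\<Sum>T\<in>tableaux A. \<Prod>k = 1..card A. 1 / (\<Sum>m = k..card A. w (inv_into A T m))) =
    (\<Sum>us\<in>linexts A. lweight w us)"
proof -
  have "(\<Prod>k = 1..card A. 1 / (\<Sum>m = k..card A. w (inv_into A T m))) =
      lweight w (map (inv_into A T) [1..<Suc (card A)])" for T
    by (subst lweight_map) (simp_all add: atLeastLessThanSuc_atLeastAtMost)
  then show ?thesis using sum.reindex_bij_betw[OF tableaux_bij[OF assms], of "lweight w"] by simp
qed

text \<open>\<open>l\<close> is an order ideal and contains the cells left of and above a minimal
  cell. Minimality forces them into \<open>g\<close>, and that is what makes the cell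
  addable.\<close>

lemma minimal_skew:
  assumes "shape l" "shape g" "cells g \<subseteq> cells l"
  shows "minimal (cells l - cells g) =
    (\<lambda>r. (r, r + g r)) ` {r. shape (bump g r) \<and> cells (bump g r) \<subseteq> cells l}"
proof (intro equalityI subsetI)
  fix u assume u: "u \<in> minimal (cells l - cells g)"
  obtain i j where ij: "u = (i, j)" by (cases u)
  have ul: "u \<in> cells l" "u \<notin> cells g" and mn: "\<And>v. v \<in> cells l \<Longrightarrow> before v u \<Longrightarrow> v \<in> cells g"
    using u by (auto simp: minimal_def)
  have v: "1 \<le> i" "i \<le> j" using cells_valid[OF assms(1) ul(1)] ij by (auto simp: valid_def)
  have "\<not> i + g i < j"
  proof
    assume "i + g i < j"
    then have "(i, i + g i) \<in> cells l"
      using cells_down[OF assms(1) ul(1), of "(i, i + g i)"] v ij by (auto simp: valid_def below_def)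
    then show False using mn[of "(i, i + g i)"] \<open>i + g i < j\<close> ij new_cell_notin by (auto simp: before_def)
  qed
  then have j: "j = i + g i" using ul(2) ij v by (auto simp: cells_def)
  have "i = 1 \<or> (\<exists>k\<ge>1. i = Suc k \<and> Suc (g i) < g k)"
  proof (cases "i = 1")
    case False
    then obtain k where k: "i = Suc k" "1 \<le> k" using v by (cases i) auto
    then have "(k, j) \<in> cells l"
      using cells_down[OF assms(1) ul(1), of "(k, j)"] v ij by (auto simp: valid_def below_def)
    then have "(k, j) \<in> cells g" using mn[of "(k, j)"] k ij by (auto simp: before_def)
    then have "Suc (g i) < g k" using j k by (auto simp: cells_def)
    then show ?thesis using k by blast
  qed simp
  then have "shape (bump g i)" using shape_bump_iff[OF assms(2)] by blast
  moreover have "cells (bump g i) \<subseteq> cells l" using ul assms(3) ij j unfolding cells_bump by blast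
  ultimately show "u \<in> (\<lambda>r. (r, r + g r)) ` {r. shape (bump g r) \<and> cells (bump g r) \<subseteq> cells l}"
    using ij j by blast
next
  fix u assume "u \<in> (\<lambda>r. (r, r + g r)) ` {r. shape (bump g r) \<and> cells (bump g r) \<subseteq> cells l}"
  then obtain r where r: "u = (r, r + g r)" "shape (bump g r)" "cells (bump g r) \<subseteq> cells l" by blast
  have "v \<in> cells g" if v: "v \<in> cells l" "before v u" for v
  proof -
    have "below v u" "v \<noteq> u" using v(2) by (auto simp: before_def below_def)
    moreover have "u \<in> cells (bump g r)" using r(1) unfolding cells_bump by simp
    ultimately have "v \<in> cells (bump g r)"
      using cells_down[OF r(2)] cells_valid[OF assms(1) v(1)] by blast
    then show ?thesis using \<open>v \<noteq> u\<close> r(1) unfolding cells_bump by blast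
  qed
  moreover have "u \<in> cells l" "u \<notin> cells g" using r new_cell_notin unfolding cells_bump by auto
  ultimately show "u \<in> minimal (cells l - cells g)" by (auto simp: minimal_def)
qed

section \<open>Comparison of the tableau recursion with the Chevalley formula\<close>

context weighted_type
begin

lemma wt_cells:
  "grow vs l \<Longrightarrow> wt x l = wt x (\<lambda>_. 0) + (\<Sum>u\<in>cells l. root (lab u) x)"
proof (induction rule: grow.induct)
  case grow_Nil
  then show ?case by (simp add: cells_zero)
next
  case (grow_Cons vs f g r)
  have sf: "shape f" using grow_Cons.hyps grow_shape by blast
  have "step f (lab (r, r + f r)) g" using stepI[OF sf, of r] grow_Cons.hyps by simp
  then have "wt x g = wt x f + root (lab (r, r + f r)) x" by (rule wt_step)
  moreover have "cells g = insert (r, r + f r) (cells f)" unfolding grow_Cons.hyps(3) by (rule cells_bump)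
  ultimately show ?case using grow_Cons.IH finite_cells[OF sf] new_cell_notin[of r f] by simp
qed

lemma excited_not_subset: "\<not> T \<subseteq> S \<Longrightarrow> excited S T = {}"
  using excited_imp_subset by blast

text \<open>No move starts at the full diagram, because the target of a move is among its own
  blocking cells. This is the base case of the comparison.\<close>

lemma excited_self: "shape l \<Longrightarrow> excited (cells l) (cells l) = {cells l}"
proof -
  assume sl: "shape l"
  have "\<not> move (cells l) (cells l) D" for D
  proof
    assume "move (cells l) (cells l) D"
    then obtain u where "u \<in> cells l" "nxt u \<in> cells l" "blk u \<inter> cells l = {}"
      unfolding move_def by blast
    then show False using nxt_blk cells_valid[OF sl] by blast
  qed
  then have "(move (cells l))\<^sup>*\<^sup>* (cells l) D \<Longrightarrow> D = cells l" for D
    by (metis converse_rtranclpE)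
  then show ?thesis by (auto simp: excited_def)
qed

lemma sum_excited_complement:
  assumes "shape l" "\<And>u. u \<in> cells l \<Longrightarrow> hook x l u \<noteq> 0"
  shows "(\<Sum>D\<in>excited (cells l) (cells g). \<Prod>u\<in>cells l - D. 1 / hook x l u) =
    1 / (\<Prod>u\<in>cells l. hook x l u) * (\<Sum>D\<in>excited (cells l) (cells g). \<Prod>u\<in>D. hook x l u)"
  unfolding sum_distrib_left
proof (intro sum.cong refl)
  fix D assume "D \<in> excited (cells l) (cells g)"
  then have D: "D \<subseteq> cells l" by (simp add: excited_def)
  have fin: "finite (cells l)" using finite_cells[OF assms(1)] .
  have "(\<Prod>u\<in>cells l. hook x l u) = (\<Prod>u\<in>cells l - D. hook x l u) * (\<Prod>u\<in>D. hook x l u)"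
    using prod.subset_diff[OF D fin] .
  moreover have "(\<Prod>u\<in>D. hook x l u) \<noteq> 0" using D assms(2) finite_subset[OF D fin] by (auto simp: prod_zero_iff)
  ultimately show "(\<Prod>u\<in>cells l - D. 1 / hook x l u) =
      1 / (\<Prod>u\<in>cells l. hook x l u) * (\<Prod>u\<in>D. hook x l u)"
    by (simp add: prod_dividef)
qed

theorem hook_formula:
  assumes l: "shape l" and g: "shape g" "cells g \<subseteq> cells l"
    and hook_nz: "\<And>u. u \<in> cells l \<Longrightarrow> hook x l u \<noteq> 0"
    and wt_nz: "\<And>A. A \<subseteq> cells l \<Longrightarrow> A \<noteq> {} \<Longrightarrow> (\<Sum>u\<in>A. root (lab u) x) \<noteq> 0"
  shows "(\<Sum>us\<in>linexts (cells l - cells g). lweight (\<lambda>u. root (lab u) x) us) =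
    (\<Sum>D\<in>excited (cells l) (cells g). \<Prod>u\<in>cells l - D. 1 / hook x l u)"
proof -
  obtain vs where vs: "grow vs l" using grow_exists[OF l] ..
  let ?w = "\<lambda>u. root (lab u) x"
  define H where "H = (\<Prod>u\<in>cells l. hook x l u)"
  have H: "H \<noteq> 0" unfolding H_def using hook_nz finite_cells[OF l] by (simp add: prod_zero_iff)
  have "(\<Sum>us\<in>linexts (cells l - cells g). lweight ?w us) = 1 / H * excited_sum x l g"
    using g
  proof (induction "card (cells l - cells g)" arbitrary: g)
    case 0
    then have "cells g = cells l" using finite_cells[OF l] by auto
    then have "g = l" by (rule cells_inj)
    then show ?case using H excited_self[OF l] by (simp add: linexts_empty excited_sum_def H_def)
  next
    case (Suc n)
    let ?A = "cells l - cells g"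
    let ?R = "{r. shape (bump g r) \<and> cells (bump g r) \<subseteq> cells l}"
    have A: "finite ?A" "?A \<noteq> {}"
      using finite_cells[OF l] Suc.hyps(2) by (simp, metis card.empty nat.distinct(1))
    have gv: "\<exists>vs. grow vs g" by (rule grow_exists[OF Suc.prems(1)])
    have "sum ?w (cells l) = sum ?w ?A + sum ?w (cells g)"
      using sum.subset_diff[OF Suc.prems(2) finite_cells[OF l]] .
    then have w: "wt x l - wt x g = sum ?w ?A" using wt_cells[OF vs, of x] gv wt_cells[of _ g x] by auto
    have IH: "(\<Sum>us\<in>linexts (?A - {(r, r + g r)}). lweight ?w us) = 1 / H * excited_sum x l (bump g r)"
      if r: "r \<in> ?R" for r
    proof -
      have eq: "?A - {(r, r + g r)} = cells l - cells (bump g r)" unfolding cells_bump by blast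
      have "(r, r + g r) \<in> ?A" using r new_cell_notin unfolding cells_bump by auto
      then have "card ?A = Suc (card (?A - {(r, r + g r)}))" using A card.remove by metis
      then have "n = card (cells l - cells (bump g r))" unfolding eq using Suc.hyps(2) by simp
      then show ?thesis unfolding eq using Suc.hyps(1) r by simp
    qed
    have cov: "{h \<in> covers g. cells h \<subseteq> cells l} = bump g ` ?R"
      using Suc.prems(1) by (auto simp: covers_def step_def)
    have inj: "inj_on (bump g) ?R"
    proof (rule inj_onI)
      fix r s assume "bump g r = bump g s"
      then have "bump g r r = bump g s r" by (rule fun_cong)
      then show "r = s" by (simp split: if_splits)
    qed
    have "(\<Sum>us\<in>linexts ?A. lweight ?w us) =
        1 / sum ?w ?A * (\<Sum>r\<in>?R. \<Sum>us\<in>linexts (?A - {(r, r + g r)}). lweight ?w us)"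
      unfolding sum_linexts[OF A] minimal_skew[OF l Suc.prems]
      by (subst sum.reindex) (auto intro: inj_onI)
    also have "\<dots> = 1 / sum ?w ?A * (1 / H * (\<Sum>r\<in>?R. excited_sum x l (bump g r)))"
      using IH by (simp add: sum_distrib_left)
    also have "(\<Sum>r\<in>?R. excited_sum x l (bump g r)) =
        (\<Sum>h | h \<in> covers g \<and> cells h \<subseteq> cells l. excited_sum x l h)"
      unfolding cov by (simp add: sum.reindex[OF inj])
    \<comment> \<open>Covers that leave \<open>l\<close> admit no excited diagrams inside
      \<open>l\<close> and contribute 0.\<close>
    also have "\<dots> = (\<Sum>h\<in>covers g. excited_sum x l h)"
      using finite_covers excited_not_subset
      by (intro sum.mono_neutral_left) (auto simp: excited_sum_def)
    also have "\<dots> = sum ?w ?A * excited_sum x l g"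
      using chevalley[OF vs Suc.prems(1), of x] w by simp
    finally show ?case using wt_nz[of ?A] A by simp
  qed
  then show ?thesis using sum_excited_complement[OF l hook_nz, where g = g]
    by (simp add: H_def excited_sum_def)
qed

end

section \<open>The hook formulas\<close>

subsection \<open>Partitions, diagrams and hooks\<close>

lemma shape_part:
  assumes "strict_partition lam"
  shows "shape (part lam)"
  unfolding shape_def
proof (intro conjI allI impI)
  show "part lam 0 = 0" by (simp add: part_def)
  show "finite {i. part lam i \<noteq> 0}"
    by (rule finite_subset[of _ "{1..length lam}"]) (auto simp: part_def split: if_splits)
  fix i :: nat assume "1 \<le> i"
  then show "part lam (Suc i) < part lam i \<or> part lam (Suc i) = 0"
    using assms by (auto simp: part_def strict_partition_def intro: sorted_wrt_nth_less)
qed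

lemma part_nonzero:
  assumes "strict_partition lam"
  shows "part lam i \<noteq> 0 \<longleftrightarrow> 1 \<le> i \<and> i \<le> length lam"
  using assms by (auto simp: part_def strict_partition_def dest: bspec[OF _ nth_mem])

lemma diagB_cells:
  assumes "strict_partition lam"
  shows "diagB lam = cells (part lam)"
proof -
  have "(i, j) \<in> diagB lam \<longleftrightarrow> (i, j) \<in> cells (part lam)" for i j
    using part_nonzero[OF assms, of i] by (auto simp: diagB_def cells_def)
  then show ?thesis by auto
qed

lemma in_to_D_image: "(i, j) \<in> to_D ` S \<longleftrightarrow> 1 \<le> j \<and> (i, j - 1) \<in> S"
  by (cases j) (force simp: to_D_def)+

lemma diagD_cells:
  assumes "strict_partition lam"
  shows "diagD lam = to_D ` cells (part lam)"
proof -
  have "(i, j) \<in> diagD lam \<longleftrightarrow> (i, j) \<in> to_D ` cells (part lam)" for i j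
    using part_nonzero[OF assms, of i] unfolding in_to_D_image by (auto simp: diagD_def cells_def)
  then show ?thesis unfolding set_eq_iff split_paired_All by blast
qed

lemma card_diagB: "card (diagB lam) = sum_list lam"
proof -
  have "diagB lam = Sigma {1..length lam} (\<lambda>i. {i..<part lam i + i})"
    unfolding diagB_def by auto
  then have "card (diagB lam) = (\<Sum>i = 1..length lam. part lam i)" by simp
  also have "\<dots> = (\<Sum>i<length lam. lam ! i)"
    by (rule sum.reindex_bij_witness[of _ Suc "\<lambda>i. i - 1"]) (auto simp: part_def)
  finally show ?thesis by (simp add: sum_list_sum_nth atLeast0LessThan)
qed

text \<open>If row \<open>j\<close> is nonempty, column \<open>j\<close> is occupied from row 1 down
  to its diagonal cell.\<close>

lemma npart_zero:
  assumes "shape f" "f j \<noteq> 0"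
  shows "npart f j = 0"
  using column_segment[OF assms(1), of j j] assms(2) by (simp add: npart_def)

lemma row_sum: "(\<Sum>v\<in>row (cells f) i. z (content v)) = sum z {..<f i}"
  by (rule sum.reindex_bij_witness[of _ "\<lambda>m. (i, i + m)" content])
     (auto simp: row_def cells_def content_def)

lemma row_from_sum:
  fixes z :: "nat \<Rightarrow> 'a::ab_group_add"
  assumes "(i, j) \<in> cells f"
  shows "(\<Sum>v\<in>row_from (cells f) (i, j). z (content v)) = sum z {..<f i} - sum z {..<j - i}"
proof -
  have "(\<Sum>v\<in>row_from (cells f) (i, j). z (content v)) = sum z {j - i..<f i}"
    using assms by (intro sum.reindex_bij_witness[of _ "\<lambda>m. (i, i + m)" content])
      (auto simp: row_from_def cells_def content_def)
  then show ?thesis using assms sum_diff_nat_ivl[of 0 "j - i" "f i" z]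
    by (auto simp: cells_def atLeast0LessThan)
qed

text \<open>Down column j the contents decrease by one from j - i - 1 to j - s, where s is the
  height of the column and j - s is \<open>npart f j\<close>.\<close>

lemma col_below_sum:
  fixes z :: "nat \<Rightarrow> 'a::ab_group_add"
  assumes "shape f" "(i, j) \<in> cells f"
  shows "(\<Sum>v\<in>col_below (cells f) (i, j). z (content v)) = sum z {..<j - i} - sum z {..<npart f j}"
proof -
  define s where "s = card {k. k \<le> j \<and> j < k + f k}"
  have seg: "k \<le> j \<and> j < k + f k \<longleftrightarrow> 1 \<le> k \<and> k \<le> s" for k
    using column_segment[OF assms(1), of k j] unfolding s_def mem_Collect_eq .
  have i: "i \<le> s" using seg[of i] assms(2) by (auto simp: cells_def)
  have s: "s \<le> j" using seg[of s] by (cases "s = 0") auto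
  have mem: "(k, j) \<in> cells f \<longleftrightarrow> 1 \<le> k \<and> k \<le> s" for k
    using seg[of k] by (auto simp: cells_def)
  have cb: "col_below (cells f) (i, j) = (\<lambda>k. (k, j)) ` {Suc i..s}"
  proof (rule set_eqI)
    fix v :: cell
    obtain k l where v: "v = (k, l)" by (cases v)
    have "(k, l) \<in> col_below (cells f) (i, j) \<longleftrightarrow> l = j \<and> i < k \<and> (k, j) \<in> cells f"
      by (auto simp: col_below_def)
    also have "\<dots> \<longleftrightarrow> l = j \<and> Suc i \<le> k \<and> k \<le> s" unfolding mem by linarith
    finally show "v \<in> col_below (cells f) (i, j) \<longleftrightarrow> v \<in> (\<lambda>k. (k, j)) ` {Suc i..s}"
      unfolding v by auto
  qed
  have "(\<Sum>v\<in>col_below (cells f) (i, j). z (content v)) = (\<Sum>k = Suc i..s. z (j - k))"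
    unfolding cb by (subst sum.reindex) (auto intro: inj_onI simp: content_def)
  also have "\<dots> = sum z {j - s..<j - i}"
    using i s by (intro sum.reindex_bij_witness[of _ "\<lambda>m. j - m" "\<lambda>k. j - k"]) auto
  finally show ?thesis using i s sum_diff_nat_ivl[of 0 "j - s" "j - i" z]
    by (simp add: atLeast0LessThan npart_def s_def[symmetric] diff_le_mono2)
qed

text \<open>The arm starts at content j - i and the leg ends its range there, so the partial sums up
  to j - i cancel. What remains is the end of the arm, the end of the leg and possibly row
  j.\<close>

lemma hB_eq:
  fixes z :: "nat \<Rightarrow> 'a::field"
  assumes lam: "strict_partition lam" and u: "u \<in> cells (part lam)"
  shows "hB z lam u = coord_hookB (\<lambda>m. sum z {..<m}) (part lam) u"
proof -
  let ?f = "part lam"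
  obtain i j where ij: "u = (i, j)" by (cases u)
  have sh: "shape ?f" using lam by (rule shape_part)
  have v: "1 \<le> i" "i \<le> j" using cells_valid[OF sh u] ij by (auto simp: valid_def)
  have nz: "j \<le> length lam \<longleftrightarrow> ?f j \<noteq> 0" using part_nonzero[OF lam, of j] v by auto
  have "npart ?f j = 0" if "?f j \<noteq> 0" using npart_zero[OF sh that] .
  then show ?thesis
    unfolding hB_def hookB_def coord_hookB_def ij Let_def diagB_cells[OF lam] fst_conv snd_conv prod.case nz
    using row_from_sum[of i j ?f z] col_below_sum[OF sh, of i j z] row_sum[where f = ?f and z = z] u ij
    by (simp flip: sum_unfold_sum_mset)
qed

lemma inj_to_D: "inj to_D"
  by (auto simp: to_D_def intro!: injI prod_eqI)

lemma content_to_D: "valid v \<Longrightarrow> content (to_D v) = Suc (content v)"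
  by (auto simp: valid_def to_D_def content_def)

lemma hD_eq:
  fixes z :: "nat \<Rightarrow> 'a::field"
  assumes lam: "strict_partition lam" and u: "u \<in> cells (part lam)"
  shows "hD z lam (to_D u) = coord_hookD (\<lambda>m. \<Sum>k<m. z (Suc k)) (part lam) u"
proof -
  let ?f = "part lam" and ?z = "\<lambda>k. z (Suc k)"
  obtain i j where ij: "u = (i, j)" by (cases u)
  have sh: "shape ?f" using lam by (rule shape_part)
  have tu: "to_D u = (i, Suc j)" by (simp add: to_D_def ij)
  have im: "row_from (to_D ` S) (i, Suc j) = to_D ` row_from S (i, j)"
    "col_below (to_D ` S) (i, Suc j) = to_D ` col_below S (i, j)"
    "row (to_D ` S) (Suc j) = to_D ` row S (Suc j)" for S
    unfolding set_eq_iff split_paired_All in_to_D_image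
    by (auto simp: row_from_def col_below_def row_def in_to_D_image)
  have shift: "(\<Sum>v\<in>#mset_set (to_D ` A). z (content v)) = (\<Sum>v\<in>A. ?z (content v))"
    if "A \<subseteq> cells ?f" for A
    unfolding sum_unfold_sum_mset[symmetric]
    using that inj_on_subset[OF inj_to_D] cells_valid[OF sh] content_to_D
    by (subst sum.reindex) (auto intro!: sum.cong)
  have "hD z lam (to_D u) = (\<Sum>v\<in>row_from (cells ?f) (i, j). ?z (content v)) +
      (\<Sum>v\<in>col_below (cells ?f) (i, j). ?z (content v)) + (\<Sum>v\<in>row (cells ?f) (Suc j). ?z (content v))"
    unfolding hD_def hookD_def Let_def diagD_cells[OF lam] tu snd_conv im image_mset_union sum_mset.union
    by (intro arg_cong2[where f = "(+)"] shift) (auto simp: row_from_def col_below_def row_def)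
  also have "\<dots> = sum ?z {..<?f i} - sum ?z {..<npart ?f j} + sum ?z {..<?f (Suc j)}"
    using row_from_sum[of i j ?f ?z] col_below_sum[OF sh, of i j ?z] row_sum[where f = ?f and z = ?z] u ij
    by simp
  \<comment> \<open>Coordinate 0 is an empty sum, so both signs of \<open>x 0\<close> in
    \<open>coord_hookD\<close> give the same value.\<close>
  also have "\<dots> = coord_hookD (\<lambda>m. \<Sum>k<m. z (Suc k)) ?f u"
  proof -
    have "?f (Suc j) \<noteq> 0 \<Longrightarrow> ?f j \<noteq> 0"
      using part_nonzero[OF lam] cells_valid[OF sh u] ij by (auto simp: valid_def)
    then show ?thesis using npart_zero[OF sh, of j] by (auto simp: coord_hookD_def ij)
  qed
  finally show ?thesis .
qed

subsection \<open>Excited moves\<close>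

lemma excitedB_eq: "excitedB lam mu = exB.excited (diagB lam) (diagB mu)"
proof -
  have "excited_moveB lam D D' \<longleftrightarrow> exB.move (diagB lam) D D'" for D D'
    unfolding excited_moveB_def exB.move_def nxtB_def blkB_def Bex_def split_paired_Ex
    by (simp add: Int_insert_left) blast
  then have "excited_moveB lam = exB.move (diagB lam)" by blast
  then show ?thesis by (simp add: excitedB_def exB.excited_def)
qed

text \<open>\<open>excited_moveD\<close> requires the whole obstruction set to lie in the diagram,
  \<open>exD.move\<close> only the target. The two agree because that set lies below the target and
  the diagram is an order ideal.\<close>

lemma excited_moveD_image:
  assumes lam: "strict_partition lam"
  shows "excited_moveD lam (to_D ` D) E \<longleftrightarrow> (\<exists>D'. E = to_D ` D' \<and> exD.move (cells (part lam)) D D')"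
proof -
  let ?S = "cells (part lam)"
  have sh: "shape (part lam)" using lam by (rule shape_part)
  have mem: "(i, Suc j) \<in> to_D ` A \<longleftrightarrow> (i, j) \<in> A" for i j A by (simp add: in_to_D_image)
  have sub: "to_D ` D \<subseteq> to_D ` ?S \<longleftrightarrow> D \<subseteq> ?S" using inj_image_subset_iff[OF inj_to_D] .
  have img: "insert (k, Suc l) (to_D ` D - {(i, Suc j)}) = to_D ` insert (k, l) (D - {(i, j)})" for i j k l
    using image_set_diff[OF inj_to_D] by (simp add: to_D_def)
  have down: "(k, l) \<in> ?S" if "(k', l') \<in> ?S" "1 \<le> k" "k \<le> l" "k \<le> k'" "l \<le> l'" for k l k' l'
    using cells_down[OF sh that(1), of "(k, l)"] that by (simp add: valid_def below_def)
  have pos: "1 \<le> i \<and> i \<le> j" if "(i, j) \<in> ?S" for i j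
    using cells_valid[OF sh that] by (simp add: valid_def)
  show ?thesis
  proof
    assume "excited_moveD lam (to_D ` D) E"
    then have D: "D \<subseteq> ?S" and
      "(\<exists>i j. (i, j) \<in> to_D ` D \<and> i + 1 < j \<and>
         {(i + 1, j), (i, j + 1), (i + 1, j + 1)} \<subseteq> to_D ` ?S - to_D ` D \<and>
         E = (to_D ` D - {(i, j)}) \<union> {(i + 1, j + 1)}) \<or>
       (\<exists>i. (i, i + 1) \<in> to_D ` D \<and>
         {(i, i + 2), (i, i + 3), (i + 1, i + 2), (i + 1, i + 3), (i + 2, i + 3)}
           \<subseteq> to_D ` ?S - to_D ` D \<and>
         E = (to_D ` D - {(i, i + 1)}) \<union> {(i + 2, i + 3)})"
      unfolding excited_moveD_def diagD_cells[OF lam] sub by blast+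
    then show "\<exists>D'. E = to_D ` D' \<and> exD.move ?S D D'"
    proof (elim disjE exE conjE)
      fix i j'
      assume h: "(i, j') \<in> to_D ` D" "i + 1 < j'"
        "{(i + 1, j'), (i, j' + 1), (i + 1, j' + 1)} \<subseteq> to_D ` ?S - to_D ` D"
        "E = (to_D ` D - {(i, j')}) \<union> {(i + 1, j' + 1)}"
      then obtain j where j: "j' = Suc j" "i < j" by (cases j') auto
      have "exD.move ?S D (insert (i + 1, Suc j) (D - {(i, j)}))"
        unfolding exD.move_def using D h(1,3) j
        by (intro conjI bexI[of _ "(i, j)"]) (simp_all add: mem nxtD_def blkD_def)
      moreover have "E = to_D ` insert (i + 1, Suc j) (D - {(i, j)})"
        using h(4) img[of "i + 1" "Suc j" i j] j by simp
      ultimately show ?thesis by blast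
    next
      fix i
      assume h: "(i, i + 1) \<in> to_D ` D"
        "{(i, i + 2), (i, i + 3), (i + 1, i + 2), (i + 1, i + 3), (i + 2, i + 3)}
           \<subseteq> to_D ` ?S - to_D ` D"
        "E = (to_D ` D - {(i, i + 1)}) \<union> {(i + 2, i + 3)}"
      have "exD.move ?S D (insert (i + 2, i + 2) (D - {(i, i)}))"
        unfolding exD.move_def using D h(1,2)
        by (intro conjI bexI[of _ "(i, i)"]) (simp_all add: mem nxtD_def blkD_def numeral_eq_Suc)
      moreover have "E = to_D ` insert (i + 2, i + 2) (D - {(i, i)})"
        using h(3) img[of "i + 2" "i + 2" i i] by (simp add: numeral_eq_Suc)
      ultimately show ?thesis by blast
    qed
  next
    assume "\<exists>D'. E = to_D ` D' \<and> exD.move ?S D D'"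
    then obtain i j where m: "D \<subseteq> ?S" "(i, j) \<in> D" "nxtD (i, j) \<in> ?S" "blkD (i, j) \<inter> D = {}"
      "E = to_D ` insert (nxtD (i, j)) (D - {(i, j)})"
      unfolding exD.move_def by auto
    have ij: "1 \<le> i" "i \<le> j" using pos m by blast+
    show "excited_moveD lam (to_D ` D) E"
      unfolding excited_moveD_def diagD_cells[OF lam] sub
    proof (intro conjI m(1))
      show "(\<exists>i j. (i, j) \<in> to_D ` D \<and> i + 1 < j \<and>
          {(i + 1, j), (i, j + 1), (i + 1, j + 1)} \<subseteq> to_D ` ?S - to_D ` D \<and>
          E = (to_D ` D - {(i, j)}) \<union> {(i + 1, j + 1)}) \<or>
        (\<exists>i. (i, i + 1) \<in> to_D ` D \<and>
          {(i, i + 2), (i, i + 3), (i + 1, i + 2), (i + 1, i + 3), (i + 2, i + 3)}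
            \<subseteq> to_D ` ?S - to_D ` D \<and>
          E = (to_D ` D - {(i, i + 1)}) \<union> {(i + 2, i + 3)})"
      proof (cases "i = j")
        case False
        then have n: "nxtD (i, j) = (Suc i, Suc j)" by (simp add: nxtD_def)
        show ?thesis
        proof (rule disjI1, rule exI[of _ i], rule exI[of _ "Suc j"], intro conjI)
          show "{(i + 1, Suc j), (i, Suc j + 1), (i + 1, Suc j + 1)} \<subseteq> to_D ` ?S - to_D ` D"
            using m(3,4) ij False down[of "Suc i" "Suc j"] unfolding n by (auto simp: mem blkD_def)
          show "E = (to_D ` D - {(i, Suc j)}) \<union> {(i + 1, Suc j + 1)}"
            using m(5) img[of "Suc i" "Suc j" i j] unfolding n by simp
        qed (use m ij False mem in auto)
      next
        case True
        then have n: "nxtD (i, j) = (Suc (Suc i), Suc (Suc i))" by (simp add: nxtD_def)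
        show ?thesis
        proof (rule disjI2, rule exI[of _ i], intro conjI)
          show "{(i, i + 2), (i, i + 3), (i + 1, i + 2), (i + 1, i + 3), (i + 2, i + 3)}
            \<subseteq> to_D ` ?S - to_D ` D"
            using m(3,4) ij True down[of "Suc (Suc i)" "Suc (Suc i)"] unfolding n
            by (auto simp: mem blkD_def numeral_eq_Suc)
          show "E = (to_D ` D - {(i, i + 1)}) \<union> {(i + 2, i + 3)}"
            using m(5) img[of "Suc (Suc i)" "Suc (Suc i)" i j] True unfolding n
            by (simp add: numeral_eq_Suc)
        qed (use m True mem in auto)
      qed
    qed
  qed
qed

lemma excitedD_eq:
  assumes "strict_partition lam" "strict_partition mu"
  shows "excitedD lam mu = (`) to_D ` exD.excited (cells (part lam)) (cells (part mu))"
proof -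
  let ?S = "cells (part lam)" and ?T = "cells (part mu)"
  have fwd: "(exD.move ?S)\<^sup>*\<^sup>* ?T D \<Longrightarrow> (excited_moveD lam)\<^sup>*\<^sup>* (to_D ` ?T) (to_D ` D)" for D
  proof (induction rule: rtranclp_induct)
    case (step D E)
    then have "excited_moveD lam (to_D ` D) (to_D ` E)" using excited_moveD_image[OF assms(1)] by blast
    then show ?case using step.IH by simp
  qed simp
  have bwd: "(excited_moveD lam)\<^sup>*\<^sup>* (to_D ` ?T) E \<Longrightarrow> \<exists>D. E = to_D ` D \<and> (exD.move ?S)\<^sup>*\<^sup>* ?T D" for E
  proof (induction rule: rtranclp_induct)
    case (step E E')
    then obtain D where D: "E = to_D ` D" "(exD.move ?S)\<^sup>*\<^sup>* ?T D" by blast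
    then obtain D' where "E' = to_D ` D'" "exD.move ?S D D'"
      using step.hyps(2) excited_moveD_image[OF assms(1)] by blast
    then show ?case using rtranclp.rtrancl_into_rtrancl[OF D(2)] by blast
  qed blast
  have sub: "to_D ` D \<subseteq> to_D ` ?S \<longleftrightarrow> D \<subseteq> ?S" for D using inj_image_subset_iff[OF inj_to_D] .
  show ?thesis
    unfolding excitedD_def exD.excited_def diagD_cells[OF assms(1)] diagD_cells[OF assms(2)]
  proof (intro equalityI subsetI)
    fix E assume "E \<in> {D. D \<subseteq> to_D ` ?S \<and> (excited_moveD lam)\<^sup>*\<^sup>* (to_D ` ?T) D}"
    then obtain D where "E = to_D ` D" "(exD.move ?S)\<^sup>*\<^sup>* ?T D" "to_D ` D \<subseteq> to_D ` ?S"
      using bwd by blast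
    then show "E \<in> (`) to_D ` {D. D \<subseteq> ?S \<and> (exD.move ?S)\<^sup>*\<^sup>* ?T D}" unfolding sub by blast
  next
    fix E assume "E \<in> (`) to_D ` {D. D \<subseteq> ?S \<and> (exD.move ?S)\<^sup>*\<^sup>* ?T D}"
    then obtain D where D: "E = to_D ` D" "D \<subseteq> ?S" "(exD.move ?S)\<^sup>*\<^sup>* ?T D" by blast
    then show "E \<in> {D. D \<subseteq> to_D ` ?S \<and> (excited_moveD lam)\<^sup>*\<^sup>* (to_D ` ?T) D}"
      using fwd image_mono by simp
  qed
qed

subsection \<open>Sums of variables\<close>

text \<open>The coefficient of a variable is its multiplicity, a positive integer and hence nonzero
  in characteristic 0.\<close>

lemma sum_mset_ratvar_nonzero:
  assumes "M \<noteq> {#}"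
  shows "(\<Sum>v\<in>#M. ratvar (c v) :: 'k::field_char_0 ratfun) \<noteq> 0"
proof -
  let ?m = "\<lambda>v. Poly_Mapping.single (c v) (1::nat)"
  let ?p = "\<lambda>M. \<Sum>v\<in>#M. Poly_Mapping.single (?m v) (1::'k)"
  have eq: "(\<Sum>v\<in>#M. ratvar (c v) :: 'k ratfun) = Fract (?p M) 1" for M
    by (induction M) (simp_all add: ratvar_def Zero_fract_def)
  have lookup: "Poly_Mapping.lookup (?p M) m = of_nat (size (filter_mset (\<lambda>v. ?m v = m) M))" for M m
    by (induction M) (simp_all add: lookup_add lookup_single when_def)
  obtain a where "a \<in># M" using assms by blast
  then have "a \<in># filter_mset (\<lambda>v. ?m v = ?m a) M" by simp
  then have "filter_mset (\<lambda>v. ?m v = ?m a) M \<noteq> {#}" by (metis empty_not_add_mset insert_DiffM)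
  then have "Poly_Mapping.lookup (?p M) (?m a) \<noteq> 0" unfolding lookup by (simp add: nonempty_has_size)
  then have "?p M \<noteq> 0" by auto
  then show ?thesis unfolding eq by (simp add: Zero_fract_def eq_fract)
qed

lemma sum_ratvar_nonzero:
  "finite A \<Longrightarrow> A \<noteq> {} \<Longrightarrow> (\<Sum>v\<in>A. ratvar (c v) :: 'k::field_char_0 ratfun) \<noteq> 0"
  unfolding sum_unfold_sum_mset by (rule sum_mset_ratvar_nonzero) (simp add: mset_set_empty_iff)

lemma SYT_eq:
  assumes "skew_size lam mu = card (skewB lam mu)"
  shows "SYT lam mu = tableaux (skewB lam mu)"
  unfolding SYT_def tableaux_def assms
  by (intro Collect_cong conj_cong refl) (auto simp: before_def split_paired_all)

theorem theorem10:
  fixes lam mu :: "nat list" and z :: "nat \<Rightarrow> ('k::field_char_0) ratfun"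
  assumes "z = ratvar"
    and "strict_partition lam" and "strict_partition mu" and "sub_partition mu lam"
  shows
    "(\<Sum>T\<in>SYT lam mu. tabB z lam mu T) =
       (\<Sum>D\<in>excitedB lam mu. \<Prod>u\<in>diagB lam - D. 1 / hB z lam u) \<and>
     (\<Sum>D\<in>excitedB lam mu. \<Prod>u\<in>diagB lam - D. 1 / hB z lam u) =
       1 / (\<Prod>u\<in>diagB lam. hB z lam u) * (\<Sum>D\<in>excitedB lam mu. \<Prod>u\<in>D. hB z lam u) \<and>
     (\<Sum>T\<in>SYT lam mu. tabD z lam mu T) =
       (\<Sum>D\<in>excitedD lam mu. \<Prod>u\<in>diagD lam - D. 1 / hD z lam u) \<and>
     (\<Sum>D\<in>excitedD lam mu. \<Prod>u\<in>diagD lam - D. 1 / hD z lam u) =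
       1 / (\<Prod>u\<in>diagD lam. hD z lam u) * (\<Sum>D\<in>excitedD lam mu. \<Prod>u\<in>D. hD z lam u)"
proof -
  note lam = assms(2) and mu = assms(3)
  let ?l = "part lam" and ?g = "part mu"
  let ?A = "cells ?l - cells ?g"
  let ?xB = "\<lambda>m. sum z {..<m}" and ?xD = "\<lambda>m. \<Sum>k<m. z (Suc k)"
  let ?B = "exB.excited (cells ?l) (cells ?g)" and ?D = "exD.excited (cells ?l) (cells ?g)"
  have l: "shape ?l" and g: "shape ?g" using lam mu shape_part by blast+
  have gl: "cells ?g \<subseteq> cells ?l"
    using assms(4) unfolding sub_partition_def diagB_cells[OF lam] diagB_cells[OF mu] .
  have fin: "finite (cells ?l)" by (rule finite_cells[OF l])
  have valid: "valid u" if "u \<in> cells ?l" for u using cells_valid[OF l that] .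
  have skew: "skewB lam mu = ?A" by (simp add: skewB_def diagB_cells lam mu)
  have size: "skew_size lam mu = card ?A"
    using card_Diff_subset[OF finite_subset[OF gl fin] gl] card_diagB[of lam] card_diagB[of mu]
    by (simp add: skew_size_def diagB_cells lam mu)
  have SYT: "SYT lam mu = tableaux ?A" using SYT_eq[of lam mu] skew size by simp
  have invA: "inv_into ?A T m \<in> cells ?l" if "T \<in> tableaux ?A" "m \<in> {1..card ?A}" for T m
    using that inv_into_into[of m T ?A] by (auto simp: tableaux_def bij_betw_def)

  have rootB: "rootB (content u) ?xB = z (content u)" for u by (simp add: rootB_def)
  \<comment> \<open>Since \<open>?xD 0\<close> is 0, the roots of labels 0 and 1 both become
    \<open>z 1\<close>.\<close>
  have rootD: "rootD (labD u) ?xD = z (content (to_D u))" if "u \<in> cells ?l" for u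
    unfolding content_to_D[OF valid[OF that]]
    using valid[OF that] by (auto simp: rootD_def labD_def content_def valid_def)

  have tabB: "(\<Sum>T\<in>SYT lam mu. tabB z lam mu T) =
      (\<Sum>us\<in>linexts ?A. lweight (\<lambda>u. rootB (content u) ?xB) us)"
    unfolding SYT rootB sum_tableaux[OF finite_Diff[OF fin], symmetric] tabB_def size cell_of_def skew ..
  have tabD: "(\<Sum>T\<in>SYT lam mu. tabD z lam mu T) =
      (\<Sum>us\<in>linexts ?A. lweight (\<lambda>u. rootD (labD u) ?xD) us)"
    unfolding SYT sum_tableaux[OF finite_Diff[OF fin], symmetric] tabD_def size cell_of_def skew
    by (intro sum.cong prod.cong arg_cong2[where f = "(/)"] refl rootD[symmetric] invA) auto

  have hB: "coord_hookB ?xB ?l u = hB z lam u" if "u \<in> cells ?l" for u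
    using hB_eq[OF lam that, symmetric] .
  have hD: "coord_hookD ?xD ?l u = hD z lam (to_D u)" if "u \<in> cells ?l" for u
    using hD_eq[OF lam that, symmetric] .
  have hB_nz: "coord_hookB ?xB ?l u \<noteq> 0" if u: "u \<in> cells ?l" for u
  proof -
    \<comment> \<open>A hook contains its own cell, so its length is a nonempty sum of
      variables.\<close>
    have "u \<in># hookB lam u"
      using u fin by (auto simp: hookB_def Let_def diagB_cells[OF lam] row_def row_from_def)
    then have "hookB lam u \<noteq> {#}" by auto
    then show ?thesis unfolding hB[OF u] hB_def unfolding assms(1) by (rule sum_mset_ratvar_nonzero)
  qed
  have hD_nz: "coord_hookD ?xD ?l u \<noteq> 0" if u: "u \<in> cells ?l" for u
  proof -
    have "to_D u \<in># hookD lam (to_D u)"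
      using u fin by (auto simp: hookD_def Let_def diagD_cells[OF lam] row_from_def)
    then have "hookD lam (to_D u) \<noteq> {#}" by auto
    then show ?thesis unfolding hD[OF u] hD_def unfolding assms(1) by (rule sum_mset_ratvar_nonzero)
  qed
  have B_nz: "(\<Sum>u\<in>A. rootB (content u) ?xB) \<noteq> 0" if "A \<subseteq> cells ?l" "A \<noteq> {}" for A
    unfolding rootB unfolding assms(1) using that finite_subset[OF _ fin] by (intro sum_ratvar_nonzero) auto
  have D_nz: "(\<Sum>u\<in>A. rootD (labD u) ?xD) \<noteq> 0" if A: "A \<subseteq> cells ?l" "A \<noteq> {}" for A
  proof -
    have "(\<Sum>u\<in>A. rootD (labD u) ?xD) = (\<Sum>u\<in>A. z (content (to_D u)))"
      using A rootD by (intro sum.cong) auto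
    also have "\<dots> \<noteq> 0" unfolding assms(1) using A finite_subset[OF _ fin] by (intro sum_ratvar_nonzero) auto
    finally show ?thesis .
  qed

  have subB: "D \<subseteq> cells ?l" if "D \<in> ?B" for D using that by (simp add: exB.excited_def)
  have subD: "D \<subseteq> cells ?l" if "D \<in> ?D" for D using that by (simp add: exD.excited_def)
  have EB: "excitedB lam mu = ?B" by (simp add: excitedB_eq diagB_cells lam mu)
  have B1: "(\<Sum>D\<in>excitedB lam mu. \<Prod>u\<in>diagB lam - D. 1 / hB z lam u) =
      (\<Sum>D\<in>?B. \<Prod>u\<in>cells ?l - D. 1 / coord_hookB ?xB ?l u)"
    unfolding EB diagB_cells[OF lam] using hB by (intro sum.cong prod.cong) auto
  have B2: "(\<Sum>D\<in>excitedB lam mu. \<Prod>u\<in>D. hB z lam u) = (\<Sum>D\<in>?B. \<Prod>u\<in>D. coord_hookB ?xB ?l u)"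
    unfolding EB by (intro sum.cong prod.cong refl hB[symmetric]) (blast dest: subB)
  have B3: "(\<Prod>u\<in>diagB lam. hB z lam u) = (\<Prod>u\<in>cells ?l. coord_hookB ?xB ?l u)"
    unfolding diagB_cells[OF lam] using hB by (intro prod.cong) auto

  have inj: "inj_on to_D A" for A using inj_to_D by (rule inj_on_subset) simp
  have injI: "inj_on ((`) to_D) X" for X
    using inj_image_eq_iff[OF inj_to_D] by (auto intro: inj_onI)
  have D1: "(\<Sum>D\<in>excitedD lam mu. \<Prod>u\<in>diagD lam - D. 1 / hD z lam u) =
      (\<Sum>D\<in>?D. \<Prod>u\<in>cells ?l - D. 1 / coord_hookD ?xD ?l u)"
    unfolding excitedD_eq[OF lam mu] diagD_cells[OF lam] sum.reindex[OF injI] o_def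
      image_set_diff[OF inj_to_D, symmetric] prod.reindex[OF inj]
    using hD by (intro sum.cong prod.cong) auto
  have D2: "(\<Sum>D\<in>excitedD lam mu. \<Prod>u\<in>D. hD z lam u) = (\<Sum>D\<in>?D. \<Prod>u\<in>D. coord_hookD ?xD ?l u)"
    unfolding excitedD_eq[OF lam mu] sum.reindex[OF injI] o_def prod.reindex[OF inj]
    by (intro sum.cong prod.cong refl hD[symmetric]) (blast dest: subD)
  have D3: "(\<Prod>u\<in>diagD lam. hD z lam u) = (\<Prod>u\<in>cells ?l. coord_hookD ?xD ?l u)"
    unfolding diagD_cells[OF lam] prod.reindex[OF inj] o_def using hD by (intro prod.cong) auto

  show ?thesis
    unfolding tabB tabD B1 B2 B3 D1 D2 D3
    using wB.hook_formula[OF l g gl hB_nz B_nz] wB.sum_excited_complement[OF l hB_nz]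
      wD.hook_formula[OF l g gl hD_nz D_nz] wD.sum_excited_complement[OF l hD_nz]
    by (intro conjI)
qed

end
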